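(* Let $(H,u)$ be an Abelian linearly ordered unital $\ell$-group and let $M$ be a weak $(H,u)$-perfect pseudo MV-algebra which is not strong. Then there is a unique (up to isomorphism) $\ell$-group $G$ with an element $b\in G$, $b\neq0$, such that $M\cong\Gamma(H\overrightarrow{\times}G,(u,b))$.
   Context: A pseudo MV-algebra is an algebra $(M;\oplus,{}^-,{}^\sim,0,1)$ of type $(2,1,1,0,0)$ such that, with $y\odot x:=(x^-\oplus y^-)^\sim$, for all $x,y,z\in M$: (A1) $x\oplus(y\oplus z)=(x\oplus y)\oplus z$; (A2) $x\oplus 0=0\oplus x=x$; (A3) $x\oplus 1=1\oplus x=1$; (A4) $1^\sim=0=1^-$; (A5) $(x^-\oplus y^-)^\sim=(x^\sim\oplus y^\sim)^-$; (A6) $x\oplus(x^\sim\odot y)=y\oplus(y^\sim\odot x)=(x\odot y^-)\oplus y=(y\odot x^-)\oplus x$; (A7) $x\odot(x^-\oplus y)=(x\oplus y^\sim)\odot y$; (A8) $(x^-)^\sim=x$ ($\odot$ binds stronger than $\oplus$). It is a distributive lattice, with $x\vee y$ given by (A6) and $x\wedge y$ by (A7). $\ell$-groups are lattice-ordered groups, written additively and not assumed Abelian; a unital $\ell$-group $(G,u)$ is an $\ell$-group with a strong unit $u\ge0$, i.e. $G=\bigcup_n[-nu,nu]$. $\Gamma(G,u)$ is the pseudo MV-algebra on $\{g\in G:0\le g\le u\}$ with $x\oplus y=(x+y)\wedge u$, $x^-=u-x$, $x^\sim=-x+u$, $x\odot y=(x-u+y)\vee 0$ and constants $0,u$. Every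 pseudo MV-algebra is isomorphic to $\Gamma(K,v)$ for a unital $\ell$-group $(K,v)$ unique up to isomorphism. $C(K)$ is the commutative center of the group $K$. On $M$, $x+y$ is defined iff $x\odot y=0$, and then $x+y:=x\oplus y$. For a linearly ordered group $H$ and an $\ell$-group $G$, $H\overrightarrow{\times}G$ is $H\times G$ with the lexicographic order: $(h,g)\le(h_1,g_1)$ iff $h<h_1$, or $h=h_1$ and $g\le g_1$. Put $[0,u]_H=\{h\in H:0\le h\le u\}$. An $(H,u)$-decomposition of $M$ is a system $(M_t:t\in[0,u]_H)$ of nonempty pairwise disjoint subsets of $M$ with union $M$ such that: (a) if $s<t$, then $a\le b$ for all $a\in M_s$, $b\in M_t$; (b) $M_t^-=M_{u-t}=M_t^\sim$ for each $t$ (elementwise negations); (c) if $x\in M_v$, $y\in M_t$, then $x\oplus y\in M_{v\oplus t}$, where $v\oplus t=\min\{v+t,u\}$. $M\cong\Gamma(K,w)$ is weak $(H,u)$-perfect if it has an $(H,u)$-decomposition $(M_t)$ and elements $(c_t:t\in[0,u]_H)$ of $M$ such that (i) $c_0=0$; (ii) $c_t\in C(K)\cap M_t$ for each $t$; (iii) $c_{v+t}=c_v+c_t$ whenever $v+t\le u$. It is strong $(H,u)$-perfect if such elements can be chosen with, in addition, $c_u=1$.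
   Formalization: Uniqueness of G from M alone fails for some (H,u), so it is proved only when (H,u) is not isomorphic to a proper quotient of itself; for every (H,u), G is proved unique among representations in which a given component M_0 corresponds to the elements (0,g). Existence is unrestricted. *)

theory Defs
  imports "HOL-Algebra.Group" "HOL-Algebra.Lattice"
begin

text \<open>
  Groups are written multiplicatively, following the library: the paper's \<open>x + y\<close>, \<open>0\<close>, \<open>-x\<close>, \<open>nx\<close>
  are \<open>x \<otimes> y\<close>, \<open>\<one>\<close>, \<open>inv x\<close>, \<open>x [^] n\<close>.
\<close>

section \<open>Lattice-ordered groups\<close>

record 'a lgroup = "'a monoid" +
  lle :: "'a \<Rightarrow> 'a \<Rightarrow> bool" (infixl \<open>\<preceq>\<index>\<close> 50)

definition lgroup_order :: "('a, 'm) lgroup_scheme \<Rightarrow> 'a gorder" where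
  "lgroup_order G = \<lparr>carrier = carrier G, eq = (=), le = lle G\<rparr>"

locale lgroup = group G + lattice "lgroup_order G" for G (structure) +
  assumes translation:
    "\<lbrakk>x \<in> carrier G; y \<in> carrier G; a \<in> carrier G; b \<in> carrier G; x \<preceq> y\<rbrakk>
      \<Longrightarrow> a \<otimes> x \<otimes> b \<preceq> a \<otimes> y \<otimes> b"

locale unital_lgroup = lgroup G for G (structure) and u +
  assumes unit_closed: "u \<in> carrier G"
    and unit_nonneg: "\<one> \<preceq> u"
    and unit_strong: "g \<in> carrier G \<Longrightarrow> \<exists>n::nat. inv (u [^] n) \<preceq> g \<and> g \<preceq> u [^] n"

locale linear_abelian_unital_lgroup =
  unital_lgroup G u + comm_group G + total_order "lgroup_order G" for G (structure) and u

definition center :: "('a, 'm) monoid_scheme \<Rightarrow> 'a set" where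
  "center G = {c \<in> carrier G. \<forall>x \<in> carrier G. c \<otimes>\<^bsub>G\<^esub> x = x \<otimes>\<^bsub>G\<^esub> c}"

definition lgroup_iso :: "('a, 'm) lgroup_scheme \<Rightarrow> ('b, 'n) lgroup_scheme \<Rightarrow> ('a \<Rightarrow> 'b) set" where
  "lgroup_iso G G' =
    {f \<in> iso G G'. \<forall>x \<in> carrier G. \<forall>y \<in> carrier G. x \<preceq>\<^bsub>G\<^esub> y \<longleftrightarrow> f x \<preceq>\<^bsub>G'\<^esub> f y}"

definition lgroup_isomorphic :: "('a, 'm) lgroup_scheme \<Rightarrow> ('b, 'n) lgroup_scheme \<Rightarrow> bool" where
  "lgroup_isomorphic G G' \<longleftrightarrow> lgroup_iso G G' \<noteq> {}"

definition lex_prod :: "('h, 'm) lgroup_scheme \<Rightarrow> ('g, 'n) lgroup_scheme \<Rightarrow> ('h \<times> 'g) lgroup" where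
  "lex_prod H G =
    \<lparr>carrier = carrier (H \<times>\<times> G), mult = mult (H \<times>\<times> G), one = one (H \<times>\<times> G),
     lle = (\<lambda>(h, g) (h', g'). (h \<preceq>\<^bsub>H\<^esub> h' \<and> h \<noteq> h') \<or> (h = h' \<and> g \<preceq>\<^bsub>G\<^esub> g'))\<rparr>"


section \<open>Pseudo MV-algebras\<close>

text \<open>\<open>lneg M x\<close> is the paper's \<open>x\<close> with superscript minus, \<open>rneg M x\<close> the one with superscript tilde.\<close>

record 'a pmv = "'a partial_object" +
  padd :: "'a \<Rightarrow> 'a \<Rightarrow> 'a" (infixl \<open>\<boxplus>\<index>\<close> 65)
  lneg :: "'a \<Rightarrow> 'a"
  rneg :: "'a \<Rightarrow> 'a"
  pzero :: 'a
  pone :: 'a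

text \<open>Note the order of the factors: the product \<open>y \<odot> x\<close> is formed from the sum of the negations
  of \<open>x\<close> and \<open>y\<close>, in this order.\<close>

definition pprod :: "('a, 'm) pmv_scheme \<Rightarrow> 'a \<Rightarrow> 'a \<Rightarrow> 'a" (infixl \<open>\<boxdot>\<index>\<close> 70) where
  "y \<boxdot>\<^bsub>M\<^esub> x = rneg M (lneg M x \<boxplus>\<^bsub>M\<^esub> lneg M y)"

locale pseudo_mv_algebra =
  fixes M :: "('a, 'm) pmv_scheme" (structure)
  assumes closed:
      "\<lbrakk>x \<in> carrier M; y \<in> carrier M\<rbrakk> \<Longrightarrow> x \<boxplus> y \<in> carrier M"
      "x \<in> carrier M \<Longrightarrow> lneg M x \<in> carrier M"
      "x \<in> carrier M \<Longrightarrow> rneg M x \<in> carrier M"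
      "pzero M \<in> carrier M" "pone M \<in> carrier M"
    and A1: "\<lbrakk>x \<in> carrier M; y \<in> carrier M; z \<in> carrier M\<rbrakk> \<Longrightarrow> x \<boxplus> (y \<boxplus> z) = (x \<boxplus> y) \<boxplus> z"
    and A2: "x \<in> carrier M \<Longrightarrow> x \<boxplus> pzero M = x" "x \<in> carrier M \<Longrightarrow> pzero M \<boxplus> x = x"
    and A3: "x \<in> carrier M \<Longrightarrow> x \<boxplus> pone M = pone M" "x \<in> carrier M \<Longrightarrow> pone M \<boxplus> x = pone M"
    and A4: "rneg M (pone M) = pzero M" "lneg M (pone M) = pzero M"
    and A5: "\<lbrakk>x \<in> carrier M; y \<in> carrier M\<rbrakk> \<Longrightarrow>
      rneg M (lneg M x \<boxplus> lneg M y) = lneg M (rneg M x \<boxplus> rneg M y)"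
    and A6:
      "\<lbrakk>x \<in> carrier M; y \<in> carrier M\<rbrakk> \<Longrightarrow> x \<boxplus> (rneg M x \<boxdot> y) = y \<boxplus> (rneg M y \<boxdot> x)"
      "\<lbrakk>x \<in> carrier M; y \<in> carrier M\<rbrakk> \<Longrightarrow> y \<boxplus> (rneg M y \<boxdot> x) = (x \<boxdot> lneg M y) \<boxplus> y"
      "\<lbrakk>x \<in> carrier M; y \<in> carrier M\<rbrakk> \<Longrightarrow> (x \<boxdot> lneg M y) \<boxplus> y = (y \<boxdot> lneg M x) \<boxplus> x"
    and A7: "\<lbrakk>x \<in> carrier M; y \<in> carrier M\<rbrakk> \<Longrightarrow>
      x \<boxdot> (lneg M x \<boxplus> y) = (x \<boxplus> rneg M y) \<boxdot> y"
    and A8: "x \<in> carrier M \<Longrightarrow> rneg M (lneg M x) = x"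

definition pjoin :: "('a, 'm) pmv_scheme \<Rightarrow> 'a \<Rightarrow> 'a \<Rightarrow> 'a" where
  "pjoin M x y = x \<boxplus>\<^bsub>M\<^esub> (rneg M x \<boxdot>\<^bsub>M\<^esub> y)"

definition pmv_le :: "('a, 'm) pmv_scheme \<Rightarrow> 'a \<Rightarrow> 'a \<Rightarrow> bool" where
  "pmv_le M x y \<longleftrightarrow> pjoin M x y = y"

text \<open>\<open>partial_sum M x y z\<close>: the partial sum \<open>x + y\<close> is defined in \<open>M\<close> and equals \<open>z\<close>.\<close>

definition partial_sum :: "('a, 'm) pmv_scheme \<Rightarrow> 'a \<Rightarrow> 'a \<Rightarrow> 'a \<Rightarrow> bool" where
  "partial_sum M x y z \<longleftrightarrow> x \<boxdot>\<^bsub>M\<^esub> y = pzero M \<and> z = x \<boxplus>\<^bsub>M\<^esub> y"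

definition pmv_iso :: "('a, 'm) pmv_scheme \<Rightarrow> ('b, 'n) pmv_scheme \<Rightarrow> ('a \<Rightarrow> 'b) set" where
  "pmv_iso M N =
    {f. bij_betw f (carrier M) (carrier N) \<and>
        (\<forall>x \<in> carrier M. \<forall>y \<in> carrier M. f (x \<boxplus>\<^bsub>M\<^esub> y) = f x \<boxplus>\<^bsub>N\<^esub> f y) \<and>
        (\<forall>x \<in> carrier M. f (lneg M x) = lneg N (f x)) \<and>
        (\<forall>x \<in> carrier M. f (rneg M x) = rneg N (f x)) \<and>
        f (pzero M) = pzero N \<and> f (pone M) = pone N}"

definition Gamma :: "('a, 'm) lgroup_scheme \<Rightarrow> 'a \<Rightarrow> 'a pmv" where
  "Gamma G u =
    \<lparr>carrier = {g \<in> carrier G. \<one>\<^bsub>G\<^esub> \<preceq>\<^bsub>G\<^esub> g \<and> g \<preceq>\<^bsub>G\<^esub> u},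
     padd = (\<lambda>x y. (x \<otimes>\<^bsub>G\<^esub> y) \<sqinter>\<^bsub>lgroup_order G\<^esub> u),
     lneg = (\<lambda>x. u \<otimes>\<^bsub>G\<^esub> inv\<^bsub>G\<^esub> x),
     rneg = (\<lambda>x. inv\<^bsub>G\<^esub> x \<otimes>\<^bsub>G\<^esub> u),
     pzero = \<one>\<^bsub>G\<^esub>,
     pone = u\<rparr>"


section \<open>Perfect pseudo MV-algebras\<close>

definition unit_interval :: "('h, 'm) lgroup_scheme \<Rightarrow> 'h \<Rightarrow> 'h set" where
  "unit_interval H u = {h \<in> carrier H. \<one>\<^bsub>H\<^esub> \<preceq>\<^bsub>H\<^esub> h \<and> h \<preceq>\<^bsub>H\<^esub> u}"

text \<open>The components are the values of \<open>Mt\<close> on \<open>unit_interval H u\<close>; other values are irrelevant.\<close>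

definition decomposition ::
  "('h, 'm) lgroup_scheme \<Rightarrow> 'h \<Rightarrow> ('a, 'n) pmv_scheme \<Rightarrow> ('h \<Rightarrow> 'a set) \<Rightarrow> bool" where
  "decomposition H u M Mt \<longleftrightarrow>
    (\<forall>t \<in> unit_interval H u. Mt t \<noteq> {}) \<and>
    (\<forall>s \<in> unit_interval H u. \<forall>t \<in> unit_interval H u. s \<noteq> t \<longrightarrow> Mt s \<inter> Mt t = {}) \<and>
    (\<Union>t \<in> unit_interval H u. Mt t) = carrier M \<and>
    (\<forall>s \<in> unit_interval H u. \<forall>t \<in> unit_interval H u. s \<preceq>\<^bsub>H\<^esub> t \<and> s \<noteq> t \<longrightarrow>
      (\<forall>a \<in> Mt s. \<forall>b \<in> Mt t. pmv_le M a b)) \<and>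
    (\<forall>t \<in> unit_interval H u.
      lneg M ` Mt t = Mt (u \<otimes>\<^bsub>H\<^esub> inv\<^bsub>H\<^esub> t) \<and> rneg M ` Mt t = Mt (u \<otimes>\<^bsub>H\<^esub> inv\<^bsub>H\<^esub> t)) \<and>
    (\<forall>v \<in> unit_interval H u. \<forall>t \<in> unit_interval H u. \<forall>x \<in> Mt v. \<forall>y \<in> Mt t.
      x \<boxplus>\<^bsub>M\<^esub> y \<in> Mt ((v \<otimes>\<^bsub>H\<^esub> t) \<sqinter>\<^bsub>lgroup_order H\<^esub> u))"

text \<open>\<open>\<phi>\<close> is an isomorphism of \<open>M\<close> onto some \<open>Gamma K w\<close>; membership of \<open>c t\<close> in the center of \<open>K\<close>
  is read through \<open>\<phi>\<close>.\<close>

definition central_system ::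
  "('h, 'm) lgroup_scheme \<Rightarrow> 'h \<Rightarrow> ('a, 'n) pmv_scheme \<Rightarrow> ('k, 'l) lgroup_scheme \<Rightarrow> ('a \<Rightarrow> 'k)
    \<Rightarrow> ('h \<Rightarrow> 'a set) \<Rightarrow> ('h \<Rightarrow> 'a) \<Rightarrow> bool" where
  "central_system H u M K \<phi> Mt c \<longleftrightarrow>
    c \<one>\<^bsub>H\<^esub> = pzero M \<and>
    (\<forall>t \<in> unit_interval H u. c t \<in> Mt t \<and> \<phi> (c t) \<in> center K) \<and>
    (\<forall>v \<in> unit_interval H u. \<forall>t \<in> unit_interval H u. v \<otimes>\<^bsub>H\<^esub> t \<preceq>\<^bsub>H\<^esub> u \<longrightarrow>
      partial_sum M (c v) (c t) (c (v \<otimes>\<^bsub>H\<^esub> t)))"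

definition weak_decomposition ::
  "('h, 'm) lgroup_scheme \<Rightarrow> 'h \<Rightarrow> ('a, 'n) pmv_scheme \<Rightarrow> ('k, 'l) lgroup_scheme \<Rightarrow> ('a \<Rightarrow> 'k)
    \<Rightarrow> ('h \<Rightarrow> 'a set) \<Rightarrow> bool" where
  "weak_decomposition H u M K \<phi> Mt \<longleftrightarrow>
    decomposition H u M Mt \<and> (\<exists>c. central_system H u M K \<phi> Mt c)"

definition weak_perfect ::
  "('h, 'm) lgroup_scheme \<Rightarrow> 'h \<Rightarrow> ('a, 'n) pmv_scheme \<Rightarrow> ('k, 'l) lgroup_scheme \<Rightarrow> ('a \<Rightarrow> 'k)
    \<Rightarrow> bool" where
  "weak_perfect H u M K \<phi> \<longleftrightarrow> (\<exists>Mt. weak_decomposition H u M K \<phi> Mt)"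

definition strong_perfect ::
  "('h, 'm) lgroup_scheme \<Rightarrow> 'h \<Rightarrow> ('a, 'n) pmv_scheme \<Rightarrow> ('k, 'l) lgroup_scheme \<Rightarrow> ('a \<Rightarrow> 'k)
    \<Rightarrow> bool" where
  "strong_perfect H u M K \<phi> \<longleftrightarrow>
    (\<exists>Mt c. decomposition H u M Mt \<and> central_system H u M K \<phi> Mt c \<and> c u = pone M)"


section \<open>Lexicographic representations\<close>

definition lex_representation ::
  "('h, 'm) lgroup_scheme \<Rightarrow> 'h \<Rightarrow> ('a, 'n) pmv_scheme \<Rightarrow> ('g, 'l) lgroup_scheme \<Rightarrow> 'g
    \<Rightarrow> ('a \<Rightarrow> 'h \<times> 'g) \<Rightarrow> bool" where
  "lex_representation H u M G b \<psi> \<longleftrightarrow>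
    lgroup G \<and> b \<in> carrier G \<and> b \<noteq> \<one>\<^bsub>G\<^esub> \<and>
    unital_lgroup (lex_prod H G) (u, b) \<and> \<psi> \<in> pmv_iso M (Gamma (lex_prod H G) (u, b))"

text \<open>\<open>\<psi>\<close> carries \<open>M0\<close> onto the elements of the lexicographic product with first coordinate zero.\<close>

definition respects_bottom ::
  "('h, 'm) lgroup_scheme \<Rightarrow> ('a, 'n) pmv_scheme \<Rightarrow> ('a \<Rightarrow> 'h \<times> 'g) \<Rightarrow> 'a set \<Rightarrow> bool" where
  "respects_bottom H M \<psi> M0 \<longleftrightarrow> {x \<in> carrier M. fst (\<psi> x) = \<one>\<^bsub>H\<^esub>} = M0"

text \<open>
  \<open>(H, u)\<close> is Hopfian if no proper quotient of it is isomorphic to it; every Archimedean \<open>H\<close>, and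
  every \<open>H\<close> with finitely many convex subgroups, has this property.  For other \<open>H\<close> the \<open>\<ell>\<close>-group \<open>G\<close> is
  not determined by \<open>M\<close> alone.  Let \<open>H\<close> be the group of finitely supported functions from the
  nonnegative rationals to the integers, ordered by the sign at the least point of the support, and
  let \<open>u\<close> have value 2 at 0 and vanish elsewhere.  Then the lexicographic product of \<open>H\<close> with itself
  is isomorphic to \<open>H\<close> by an isomorphism sending \<open>(u, 0)\<close> to \<open>u\<close>.  With \<open>G\<close> the integers and \<open>b = 1\<close>,
  and with \<open>G\<close> the lexicographic product of \<open>H\<close> and the integers and \<open>b = (0, 1)\<close>, one obtains the
  same pseudo MV-algebra, which is weak and not strong because its unit is not of the form \<open>c + c\<close>.
  In general \<open>G\<close> is determined by \<open>M\<close> together with the component \<open>Mt 0\<close> of its decomposition.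
\<close>

definition hopfian :: "('h, 'm) lgroup_scheme \<Rightarrow> 'h \<Rightarrow> bool" where
  "hopfian H u \<longleftrightarrow>
    (\<forall>f \<in> hom H H.
      (\<forall>x \<in> carrier H. \<forall>y \<in> carrier H. x \<preceq>\<^bsub>H\<^esub> y \<longrightarrow> f x \<preceq>\<^bsub>H\<^esub> f y) \<and>
      f u = u \<and> f ` carrier H = carrier H \<longrightarrow> inj_on f (carrier H))"

end

theory Submission
  imports Defs
begin

text \<open>
  Existence: the elements of \<open>K\<close> between \<open>-x\<close> and \<open>y\<close>, for \<open>x, y \<in> M\<^sub>0\<close>, form a convex subgroup \<open>G\<close>, and
  subtracting the central element \<open>c\<^sub>t\<close> from \<open>x \<in> M\<^sub>t\<close> leaves an element of \<open>G\<close>; so \<open>x\<close> corresponds to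
  \<open>(t, x - c\<^sub>t)\<close> and \<open>b\<close> is \<open>1 - c\<^sub>u\<close>, which is nonzero because \<open>M\<close> is not strong.  If \<open>H\<close> is
  trivial, then \<open>M\<^sub>0 = M\<close>, its sums need not stay in \<open>M\<close>, and one takes \<open>G = K\<close> instead.

  Uniqueness: an isomorphism between two unit intervals \<open>\<Gamma>(G,v)\<close> and \<open>\<Gamma>(G',v')\<close> extends to the
  \<open>\<ell>\<close>-groups.  Applied to two lexicographic products it carries the bottom layer of the first onto
  a convex subgroup comparable with the bottom layer of the second; the layers agree if \<open>M\<^sub>0\<close> is
  prescribed, or if \<open>H\<close> has no proper quotient isomorphic to itself.
\<close>

section \<open>Lattice-ordered groups\<close>

text \<open>The difficulty in extending an isomorphism of unit intervals is that a positive element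
  is a sum of interval elements in many ways. Sums are therefore paired with the sums of the images
  as a relation. The lattice structure shows that a smaller sum can be subtracted from a larger one
  within this relation; the difference is a sum again, hence nonnegative, so order is preserved, and
  antisymmetry gives single-valuedness. Since the groups need not be Abelian, general elements are
  handled as left quotients, brought to a common denominator by means of an upper bound.

  An isomorphism of lexicographic products over \<open>H\<close> may move the bottom layer, and this
  alone can keep it from restricting to an isomorphism of \<open>G\<close> with \<open>G'\<close>.
  If one bottom layer is mapped into the other, there remains an order-preserving map of
  \<open>H\<close> onto itself fixing \<open>u\<close>, which explains the Hopfian condition.

  In the construction of \<open>G\<close>, centrality of \<open>c t\<close> makes its subtraction
  compatible with addition and negation. Truncation at the unit is delicate only where the layer
  indices add up to exactly \<open>u\<close>.\<close>

lemma lgroup_order_sel [simp]: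
  "carrier (lgroup_order G) = carrier G"
  "le (lgroup_order G) = lle G"
  "eq (lgroup_order G) = (=)"
  by (simp_all add: lgroup_order_def)

text \<open>Only joins have to be supplied: negation reverses the order, so the meet of
  \<open>x\<close> and \<open>y\<close> is the negative of the join of their negatives.\<close>

lemma lgroupI:
  fixes G (structure)
  assumes "group G"
    and refl: "\<And>x. x \<in> carrier G \<Longrightarrow> x \<preceq> x"
    and antisym: "\<And>x y. \<lbrakk>x \<in> carrier G; y \<in> carrier G; x \<preceq> y; y \<preceq> x\<rbrakk> \<Longrightarrow> x = y"
    and trans: "\<And>x y z. \<lbrakk>x \<in> carrier G; y \<in> carrier G; z \<in> carrier G; x \<preceq> y; y \<preceq> z\<rbrakk> \<Longrightarrow> x \<preceq> z"
    and sup: "\<And>x y. \<lbrakk>x \<in> carrier G; y \<in> carrier G\<rbrakk> \<Longrightarrow>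
      \<exists>s \<in> carrier G. x \<preceq> s \<and> y \<preceq> s \<and> (\<forall>z \<in> carrier G. x \<preceq> z \<and> y \<preceq> z \<longrightarrow> s \<preceq> z)"
    and translation: "\<And>x y a b.
      \<lbrakk>x \<in> carrier G; y \<in> carrier G; a \<in> carrier G; b \<in> carrier G; x \<preceq> y\<rbrakk>
        \<Longrightarrow> a \<otimes> x \<otimes> b \<preceq> a \<otimes> y \<otimes> b"
  shows "lgroup G"
proof -
  interpret group G by fact
  have po: "partial_order (lgroup_order G)"
    by unfold_locales (auto intro: refl antisym trans)
  have anti: "inv y \<preceq> inv x" if "x \<in> carrier G" "y \<in> carrier G" "x \<preceq> y" for x y
    using translation[of x y "inv x" "inv y"] that by (simp add: m_assoc)
  have "\<exists>s. least (lgroup_order G) s (Upper (lgroup_order G) {x, y})"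
    if xy: "x \<in> carrier G" "y \<in> carrier G" for x y
    using sup[OF xy] xy unfolding least_def Upper_def by fastforce
  moreover have "\<exists>s. greatest (lgroup_order G) s (Lower (lgroup_order G) {x, y})"
    if xy: "x \<in> carrier G" "y \<in> carrier G" for x y
  proof -
    obtain s where s: "s \<in> carrier G" "inv x \<preceq> s" "inv y \<preceq> s"
      "\<And>z. \<lbrakk>z \<in> carrier G; inv x \<preceq> z; inv y \<preceq> z\<rbrakk> \<Longrightarrow> s \<preceq> z"
      using sup[of "inv x" "inv y"] xy by auto
    have "inv s \<preceq> x" "inv s \<preceq> y"
      using anti[of "inv x" s] anti[of "inv y" s] s xy by auto
    moreover have "z \<preceq> inv s" if "z \<in> carrier G" "z \<preceq> x" "z \<preceq> y" for z
      using anti[OF s(1) inv_closed[OF that(1)] s(4)] anti that xy by auto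
    ultimately show ?thesis
      using s(1) xy unfolding greatest_def Lower_def by fastforce
  qed
  ultimately show ?thesis
    unfolding lgroup_def lattice_def upper_semilattice_def lower_semilattice_def
      upper_semilattice_axioms_def lower_semilattice_axioms_def lgroup_axioms_def
    using po translation by (auto intro: group_axioms)
qed

context lgroup
begin

lemma mult_inv_cancel [simp]:
  assumes "x \<in> carrier G" "y \<in> carrier G"
  shows "x \<otimes> (inv x \<otimes> y) = y" "inv x \<otimes> (x \<otimes> y) = y"
  using assms by (simp_all flip: m_assoc)

lemma lle_refl [simp]: "x \<in> carrier G \<Longrightarrow> x \<preceq> x"
  using le_refl by simp

lemma lle_antisym: "\<lbrakk>x \<preceq> y; y \<preceq> x; x \<in> carrier G; y \<in> carrier G\<rbrakk> \<Longrightarrow> x = y"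
  using le_antisym by simp

lemma lle_trans: "\<lbrakk>x \<preceq> y; y \<preceq> z; x \<in> carrier G; y \<in> carrier G; z \<in> carrier G\<rbrakk> \<Longrightarrow> x \<preceq> z"
  using le_trans by simp

lemma mult_left_le_iff [simp]:
  assumes "x \<in> carrier G" "y \<in> carrier G" "a \<in> carrier G"
  shows "a \<otimes> x \<preceq> a \<otimes> y \<longleftrightarrow> x \<preceq> y"
proof
  assume "x \<preceq> y" then show "a \<otimes> x \<preceq> a \<otimes> y"
    using translation[of x y a \<one>] assms by simp
next
  assume "a \<otimes> x \<preceq> a \<otimes> y" then show "x \<preceq> y"
    using translation[of "a \<otimes> x" "a \<otimes> y" "inv a" \<one>] assms by simp
qed

lemma mult_right_le_iff [simp]:
  assumes "x \<in> carrier G" "y \<in> carrier G" "a \<in> carrier G"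
  shows "x \<otimes> a \<preceq> y \<otimes> a \<longleftrightarrow> x \<preceq> y"
proof
  assume "x \<preceq> y" then show "x \<otimes> a \<preceq> y \<otimes> a"
    using translation[of x y \<one> a] assms by simp
next
  assume "x \<otimes> a \<preceq> y \<otimes> a" then show "x \<preceq> y"
    using translation[of "x \<otimes> a" "y \<otimes> a" \<one> "inv a"] assms by (simp add: m_assoc)
qed

lemma mult_le_mono:
  assumes "x \<preceq> y" "x' \<preceq> y'" "x \<in> carrier G" "y \<in> carrier G" "x' \<in> carrier G" "y' \<in> carrier G"
  shows "x \<otimes> x' \<preceq> y \<otimes> y'"
  using assms by (intro lle_trans[of "x \<otimes> x'" "y \<otimes> x'" "y \<otimes> y'"]) auto

lemma le_mult_self_iff [simp]:
  assumes "x \<in> carrier G" "y \<in> carrier G"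
  shows "x \<preceq> x \<otimes> y \<longleftrightarrow> \<one> \<preceq> y" "x \<preceq> y \<otimes> x \<longleftrightarrow> \<one> \<preceq> y"
    "x \<otimes> y \<preceq> x \<longleftrightarrow> y \<preceq> \<one>" "y \<otimes> x \<preceq> x \<longleftrightarrow> y \<preceq> \<one>"
  using mult_left_le_iff[of \<one> y x] mult_right_le_iff[of \<one> y x]
    mult_left_le_iff[of y \<one> x] mult_right_le_iff[of y \<one> x] assms by simp_all

lemma mult_nonneg: "\<lbrakk>\<one> \<preceq> x; \<one> \<preceq> y; x \<in> carrier G; y \<in> carrier G\<rbrakk> \<Longrightarrow> \<one> \<preceq> x \<otimes> y"
  using mult_le_mono[of \<one> x \<one> y] by simp

lemma inv_mult_le_iff:
  assumes "x \<in> carrier G" "y \<in> carrier G" "z \<in> carrier G"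
  shows "inv x \<otimes> y \<preceq> z \<longleftrightarrow> y \<preceq> x \<otimes> z" "y \<otimes> inv x \<preceq> z \<longleftrightarrow> y \<preceq> z \<otimes> x"
    "z \<preceq> inv x \<otimes> y \<longleftrightarrow> x \<otimes> z \<preceq> y" "z \<preceq> y \<otimes> inv x \<longleftrightarrow> z \<otimes> x \<preceq> y"
  using mult_left_le_iff[of "inv x \<otimes> y" z x] mult_right_le_iff[of "y \<otimes> inv x" z x]
    mult_left_le_iff[of z "inv x \<otimes> y" x] mult_right_le_iff[of z "y \<otimes> inv x" x] assms
  by (simp_all add: m_assoc del: mult_left_le_iff mult_right_le_iff)

lemma inv_le_inv_iff [simp]:
  assumes "x \<in> carrier G" "y \<in> carrier G"
  shows "inv x \<preceq> inv y \<longleftrightarrow> y \<preceq> x"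
  using inv_mult_le_iff(1)[of x \<one> "inv y"] inv_mult_le_iff(4)[of y x \<one>] assms by simp

lemma inv_le_one_iff [simp]:
  assumes "x \<in> carrier G"
  shows "inv x \<preceq> \<one> \<longleftrightarrow> \<one> \<preceq> x" "\<one> \<preceq> inv x \<longleftrightarrow> x \<preceq> \<one>"
  using inv_le_inv_iff[of x \<one>] inv_le_inv_iff[of \<one> x] assms by simp_all

lemma obtain_sup:
  assumes "x \<in> carrier G" "y \<in> carrier G"
  obtains s where "s \<in> carrier G" "x \<preceq> s" "y \<preceq> s"
    "\<And>z. \<lbrakk>z \<in> carrier G; x \<preceq> z; y \<preceq> z\<rbrakk> \<Longrightarrow> s \<preceq> z"
proof -
  let ?L = "lgroup_order G"
  have "x \<preceq> x \<squnion>\<^bsub>?L\<^esub> y" "y \<preceq> x \<squnion>\<^bsub>?L\<^esub> y" "x \<squnion>\<^bsub>?L\<^esub> y \<in> carrier G"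
    using join_left[of x y] join_right[of x y] join_closed[of x y] assms by auto
  moreover have "x \<squnion>\<^bsub>?L\<^esub> y \<preceq> z" if "z \<in> carrier G" "x \<preceq> z" "y \<preceq> z" for z
    using join_le[of x z y] assms that by simp
  ultimately show thesis using that by blast
qed

lemma meet_lle:
  assumes "x \<in> carrier G" "y \<in> carrier G"
  shows "x \<sqinter>\<^bsub>lgroup_order G\<^esub> y \<preceq> x" "x \<sqinter>\<^bsub>lgroup_order G\<^esub> y \<preceq> y"
    "x \<sqinter>\<^bsub>lgroup_order G\<^esub> y \<in> carrier G"
  using meet_left[of x y] meet_right[of x y] meet_closed[of x y] assms by auto

lemma lle_meet:
  "\<lbrakk>z \<preceq> x; z \<preceq> y; x \<in> carrier G; y \<in> carrier G; z \<in> carrier G\<rbrakk>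
    \<Longrightarrow> z \<preceq> x \<sqinter>\<^bsub>lgroup_order G\<^esub> y"
  using meet_le[of z x y] by simp

lemma meet_eqI:
  assumes "z \<preceq> x" "z \<preceq> y" "x \<in> carrier G" "y \<in> carrier G" "z \<in> carrier G"
    and "\<And>k. \<lbrakk>k \<in> carrier G; k \<preceq> x; k \<preceq> y\<rbrakk> \<Longrightarrow> k \<preceq> z"
  shows "x \<sqinter>\<^bsub>lgroup_order G\<^esub> y = z"
  using assms meet_lle[of x y] lle_meet[of z x y] by (auto intro: lle_antisym)

lemma meet_absorb:
  assumes "x \<in> carrier G" "y \<in> carrier G"
  shows "x \<preceq> y \<Longrightarrow> x \<sqinter>\<^bsub>lgroup_order G\<^esub> y = x" "y \<preceq> x \<Longrightarrow> x \<sqinter>\<^bsub>lgroup_order G\<^esub> y = y"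
  using assms by (auto intro: meet_eqI)

text \<open>With \<open>a\<close> an upper bound of zero and \<open>-g\<close>, the equation
  \<open>g = -a + (a + g)\<close> presents any \<open>g\<close> as a difference of two nonnegative
  elements.\<close>

lemma obtain_nonneg_quotient:
  assumes "g \<in> carrier G"
  obtains a where "a \<in> carrier G" "\<one> \<preceq> a" "\<one> \<preceq> a \<otimes> g"
proof -
  obtain a where a: "a \<in> carrier G" "\<one> \<preceq> a" "inv g \<preceq> a"
    using obtain_sup[of \<one> "inv g"] assms by auto
  have "\<one> \<preceq> a \<otimes> g"
    using a mult_right_le_iff[of "inv g" a g] assms by simp
  then show thesis using a that by blast
qed

section \<open>Operations of the unit interval\<close>

lemma Gamma_carrier [simp]:
  "x \<in> carrier (Gamma G v) \<longleftrightarrow> x \<in> carrier G \<and> \<one> \<preceq> x \<and> x \<preceq> v"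
  by (simp add: Gamma_def)

lemma Gamma_neg_closed:
  assumes "v \<in> carrier G" "x \<in> carrier (Gamma G v)"
  shows "lneg (Gamma G v) x \<in> carrier (Gamma G v)" "rneg (Gamma G v) x \<in> carrier (Gamma G v)"
  using assms by (auto simp: inv_mult_le_iff) (auto simp: Gamma_def inv_mult_le_iff)

lemma Gamma_padd_closed:
  assumes "v \<in> carrier G" "\<one> \<preceq> v" "x \<in> carrier (Gamma G v)" "y \<in> carrier (Gamma G v)"
  shows "x \<boxplus>\<^bsub>Gamma G v\<^esub> y \<in> carrier (Gamma G v)"
  using assms meet_lle[of "x \<otimes> y" v]
  by (auto intro!: lle_meet mult_nonneg) (auto simp: Gamma_def intro!: lle_meet mult_nonneg)

text \<open>An equation between the operations that detects an inequality in the group; isomorphisms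
  of unit intervals preserve such equations and thereby the order.\<close>

lemma Gamma_padd_eq_unit_iff:
  assumes "v \<in> carrier G" "x \<in> carrier G" "y \<in> carrier G"
  shows "x \<boxplus>\<^bsub>Gamma G v\<^esub> y = v \<longleftrightarrow> v \<preceq> x \<otimes> y"
  using assms meet_absorb(2)[of "x \<otimes> y" v] meet_lle[of "x \<otimes> y" v] by (auto simp: Gamma_def)

lemma Gamma_padd_eq_mult:
  assumes "v \<in> carrier G" "x \<in> carrier G" "y \<in> carrier G" "x \<otimes> y \<preceq> v"
  shows "x \<boxplus>\<^bsub>Gamma G v\<^esub> y = x \<otimes> y"
  using assms meet_absorb(1)[of "x \<otimes> y" v] by (simp add: Gamma_def)

end

section \<open>Isomorphisms of pseudo MV-algebras\<close>

lemma pmv_isoD: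
  assumes "f \<in> pmv_iso M N"
  shows "bij_betw f (carrier M) (carrier N)"
    "x \<in> carrier M \<Longrightarrow> f x \<in> carrier N"
    "\<lbrakk>x \<in> carrier M; y \<in> carrier M\<rbrakk> \<Longrightarrow> f (x \<boxplus>\<^bsub>M\<^esub> y) = f x \<boxplus>\<^bsub>N\<^esub> f y"
    "x \<in> carrier M \<Longrightarrow> f (lneg M x) = lneg N (f x)"
    "x \<in> carrier M \<Longrightarrow> f (rneg M x) = rneg N (f x)"
    "f (pzero M) = pzero N" "f (pone M) = pone N"
    "\<lbrakk>x \<in> carrier M; y \<in> carrier M\<rbrakk> \<Longrightarrow> f x = f y \<longleftrightarrow> x = y"
  using assms by (auto simp: pmv_iso_def bij_betw_def inj_on_def)

lemma pmv_iso_comp: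
  assumes "f \<in> pmv_iso L M" "g \<in> pmv_iso M N"
  shows "g \<circ> f \<in> pmv_iso L N"
  using pmv_isoD[OF assms(1)] pmv_isoD[OF assms(2)]
  by (auto simp: pmv_iso_def intro: bij_betw_trans)

text \<open>The closure properties are listed separately so that they can come either from the
  axioms of a pseudo MV-algebra or, for \<open>Gamma\<close>, directly from the group.\<close>

lemma pmv_iso_inv:
  assumes f: "f \<in> pmv_iso M N"
    and closed: "\<And>x y. \<lbrakk>x \<in> carrier M; y \<in> carrier M\<rbrakk> \<Longrightarrow> x \<boxplus>\<^bsub>M\<^esub> y \<in> carrier M"
      "\<And>x. x \<in> carrier M \<Longrightarrow> lneg M x \<in> carrier M" "\<And>x. x \<in> carrier M \<Longrightarrow> rneg M x \<in> carrier M"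
      "pzero M \<in> carrier M" "pone M \<in> carrier M"
  shows "inv_into (carrier M) f \<in> pmv_iso N M"
proof -
  note fD = pmv_isoD[OF f]
  let ?g = "inv_into (carrier M) f"
  have g: "?g y \<in> carrier M" "f (?g y) = y" if "y \<in> carrier N" for y
    using fD(1) that by (auto simp: bij_betw_def inv_into_into f_inv_into_f)
  have eq: "?g y = x" if "x \<in> carrier M" "y = f x" for x y
    using fD(1) that by (auto simp: bij_betw_def)
  show ?thesis
    unfolding pmv_iso_def
    by (auto simp: fD g closed intro!: bij_betw_inv_into eq)
qed

section \<open>Extending isomorphisms of unit intervals\<close>

text \<open>The intended additive extension of \<open>f\<close> to nonnegative elements, kept as a
  relation because different decompositions of one element might a priori give different
  images.\<close>

inductive interval_sum ::
  "('a, 'm) lgroup_scheme \<Rightarrow> 'a \<Rightarrow> ('b, 'n) lgroup_scheme \<Rightarrow> ('a \<Rightarrow> 'b) \<Rightarrow> 'a \<Rightarrow> 'b \<Rightarrow> bool"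
  for G v G' f where
  zero: "interval_sum G v G' f \<one>\<^bsub>G\<^esub> \<one>\<^bsub>G'\<^esub>"
| add: "\<lbrakk>y \<in> carrier (Gamma G v); interval_sum G v G' f c c'\<rbrakk>
    \<Longrightarrow> interval_sum G v G' f (y \<otimes>\<^bsub>G\<^esub> c) (f y \<otimes>\<^bsub>G'\<^esub> c')"

text \<open>Pairs a difference of two sums with the difference of their images. The negative term
  stands on the left throughout, a choice that matters in a noncommutative group.\<close>

definition extension ::
  "('a, 'm) lgroup_scheme \<Rightarrow> 'a \<Rightarrow> ('b, 'n) lgroup_scheme \<Rightarrow> ('a \<Rightarrow> 'b) \<Rightarrow> 'a \<Rightarrow> 'b \<Rightarrow> bool" where
  "extension G v G' f g g' \<longleftrightarrow>
    (\<exists>a a' b b'. interval_sum G v G' f a a' \<and> interval_sum G v G' f b b' \<and>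
      g = inv\<^bsub>G\<^esub> a \<otimes>\<^bsub>G\<^esub> b \<and> g' = inv\<^bsub>G'\<^esub> a' \<otimes>\<^bsub>G'\<^esub> b')"

locale gamma_iso = G: unital_lgroup G v + G': unital_lgroup G' v'
  for G :: "('a, 'm) lgroup_scheme" (structure) and v
    and G' :: "('b, 'n) lgroup_scheme" (structure) and v' +
  fixes f :: "'a \<Rightarrow> 'b"
  assumes iso: "f \<in> pmv_iso (Gamma G v) (Gamma G' v')"
begin

lemmas unit_simps [simp] =
  G.unit_closed G.unit_nonneg G'.unit_closed G'.unit_nonneg

lemma Gamma_pone_pzero [simp]:
  "pone (Gamma G v) = v" "pzero (Gamma G v) = \<one>"
  "pone (Gamma G' v') = v'" "pzero (Gamma G' v') = \<one>\<^bsub>G'\<^esub>"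
  by (simp_all add: Gamma_def)

lemma f_one: "f \<one> = \<one>\<^bsub>G'\<^esub>" and f_unit: "f v = v'"
  using pmv_isoD(6,7)[OF iso] by simp_all

lemma f_Gamma:
  assumes "x \<in> carrier (Gamma G v)"
  shows "f x \<in> carrier G'" "\<one>\<^bsub>G'\<^esub> \<preceq>\<^bsub>G'\<^esub> f x" "f x \<preceq>\<^bsub>G'\<^esub> v'" "f x \<in> carrier (Gamma G' v')"
  using pmv_isoD(2)[OF iso assms] by simp_all

text \<open>Makes the situation symmetric: order reflection follows from order preservation for the
  inverse, and surjectivity of the extension from totality for the inverse.\<close>

lemma inverse_iso: "gamma_iso G' v' G v (inv_into (carrier (Gamma G v)) f)"
proof -
  have "inv_into (carrier (Gamma G v)) f \<in> pmv_iso (Gamma G' v') (Gamma G v)"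
    using G.Gamma_neg_closed[of v] G.Gamma_padd_closed[of v]
    by (intro pmv_iso_inv[OF iso]) auto
  then show ?thesis
    by (simp add: gamma_iso_def gamma_iso_axioms_def G.unital_lgroup_axioms G'.unital_lgroup_axioms)
qed

text \<open>In the unit interval \<open>x \<preceq> y\<close> holds exactly when the left negation
  of \<open>x\<close> added to \<open>y\<close> gives the unit, a condition built from operations
  that \<open>f\<close> preserves.\<close>

lemma f_le_iff:
  assumes "x \<in> carrier (Gamma G v)" "y \<in> carrier (Gamma G v)"
  shows "x \<preceq> y \<longleftrightarrow> f x \<preceq>\<^bsub>G'\<^esub> f y"
proof -
  let ?n = "lneg (Gamma G v) x"
  have n: "?n \<in> carrier (Gamma G v)"
    using G.Gamma_neg_closed assms by simp
  have "?n \<boxplus>\<^bsub>Gamma G v\<^esub> y = v \<longleftrightarrow> f (?n \<boxplus>\<^bsub>Gamma G v\<^esub> y) = v'"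
    using G.Gamma_padd_closed[OF _ _ n assms(2)] pmv_isoD(8)[OF iso, of "?n \<boxplus>\<^bsub>Gamma G v\<^esub> y" v]
    by (simp add: f_unit)
  also have "\<dots> \<longleftrightarrow> lneg (Gamma G' v') (f x) \<boxplus>\<^bsub>Gamma G' v'\<^esub> f y = v'"
    using n assms by (simp add: pmv_isoD(3,4)[OF iso])
  finally show ?thesis
    using n assms f_Gamma[OF assms(1)] f_Gamma[OF assms(2)]
      G'.Gamma_neg_closed(1)[of v' "f x"] G.Gamma_padd_eq_unit_iff[of v ?n y]
      G'.Gamma_padd_eq_unit_iff[of v' "lneg (Gamma G' v') (f x)" "f y"]
    by (simp add: Gamma_def G.m_assoc G'.m_assoc G.inv_mult_le_iff G'.inv_mult_le_iff)
qed

text \<open>The condition \<open>x \<otimes> y \<preceq> v\<close> means that \<open>x\<close> lies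
  below the left negation of \<open>y\<close>, so it passes to the images. Truncation is then
  inactive on both sides.\<close>

lemma f_mult:
  assumes "x \<in> carrier (Gamma G v)" "y \<in> carrier (Gamma G v)" "x \<otimes> y \<preceq> v"
  shows "f (x \<otimes> y) = f x \<otimes>\<^bsub>G'\<^esub> f y"
proof -
  have n: "lneg (Gamma G v) y \<in> carrier (Gamma G v)" "lneg (Gamma G v) y = v \<otimes> inv y"
    using G.Gamma_neg_closed assms by (simp_all add: Gamma_def)
  then have "x \<preceq> lneg (Gamma G v) y"
    using assms by (simp add: G.inv_mult_le_iff)
  then have "f x \<preceq>\<^bsub>G'\<^esub> lneg (Gamma G' v') (f y)"
    using f_le_iff[OF assms(1) n(1)] pmv_isoD(4)[OF iso assms(2)] by simp
  then have "f x \<otimes>\<^bsub>G'\<^esub> f y \<preceq>\<^bsub>G'\<^esub> v'"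
    using f_Gamma[OF assms(1)] f_Gamma[OF assms(2)] by (simp add: Gamma_def G'.inv_mult_le_iff)
  then show ?thesis
    using pmv_isoD(3)[OF iso assms(1,2)] G.Gamma_padd_eq_mult[of v x y]
      G'.Gamma_padd_eq_mult[of v' "f x" "f y"] assms f_Gamma
    by simp
qed

lemma f_diff:
  assumes "x \<in> carrier (Gamma G v)" "y \<in> carrier (Gamma G v)" "x \<preceq> y"
  shows "inv x \<otimes> y \<in> carrier (Gamma G v)" "f (inv x \<otimes> y) = inv\<^bsub>G'\<^esub> f x \<otimes>\<^bsub>G'\<^esub> f y"
proof -
  have "v \<preceq> x \<otimes> v" using assms by simp
  then have "y \<preceq> x \<otimes> v" using assms by (auto intro: G.lle_trans[of y v])
  then show d: "inv x \<otimes> y \<in> carrier (Gamma G v)"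
    using assms by (auto simp: G.inv_mult_le_iff)
  have "f y = f x \<otimes>\<^bsub>G'\<^esub> f (inv x \<otimes> y)"
    using f_mult[OF assms(1) d] assms by simp
  then show "f (inv x \<otimes> y) = inv\<^bsub>G'\<^esub> f x \<otimes>\<^bsub>G'\<^esub> f y"
    using f_Gamma[OF d] f_Gamma[OF assms(1)] by simp
qed

section \<open>Sums of interval elements\<close>

abbreviation sum_rel (infix \<open>\<leadsto>\<close> 50) where
  "a \<leadsto> a' \<equiv> interval_sum G v G' f a a'"

lemma sum_closed:
  assumes "a \<leadsto> a'"
  shows "a \<in> carrier G" "\<one> \<preceq> a" "a' \<in> carrier G'" "\<one>\<^bsub>G'\<^esub> \<preceq>\<^bsub>G'\<^esub> a'"
  using assms
proof induction
  case (add y c c')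
  show "y \<otimes> c \<in> carrier G" "\<one> \<preceq> y \<otimes> c"
      "f y \<otimes>\<^bsub>G'\<^esub> c' \<in> carrier G'" "\<one>\<^bsub>G'\<^esub> \<preceq>\<^bsub>G'\<^esub> f y \<otimes>\<^bsub>G'\<^esub> c'"
    using add f_Gamma[OF add.hyps(1)] by (simp_all add: G.mult_nonneg G'.mult_nonneg)
qed auto

lemma sum_inverse:
  assumes "a \<leadsto> a'"
  shows "interval_sum G' v' G (inv_into (carrier (Gamma G v)) f) a' a"
  using assms
proof induction
  case (add y c c')
  have "inj_on f (carrier (Gamma G v))"
    using pmv_isoD(1)[OF iso] by (simp add: bij_betw_def)
  then have "inv_into (carrier (Gamma G v)) f (f y) = y"
    using add by (simp add: inv_into_f_f)
  then show ?case
    using interval_sum.add[OF f_Gamma(4) add.IH, of y] add.hyps by simp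
qed (rule interval_sum.zero)

lemma sum_mult: "\<lbrakk>a \<leadsto> a'; b \<leadsto> b'\<rbrakk> \<Longrightarrow> a \<otimes> b \<leadsto> a' \<otimes>\<^bsub>G'\<^esub> b'"
proof (induction rule: interval_sum.induct)
  case zero
  then show ?case using sum_closed[of b b'] by simp
next
  case (add y c c')
  then show ?case
    using interval_sum.add[of y G v G' f "c \<otimes> b" "c' \<otimes>\<^bsub>G'\<^esub> b'"] sum_closed[OF add.prems]
      sum_closed[OF add.hyps(2)] f_Gamma[OF add.hyps(1)]
    by (simp add: G.m_assoc G'.m_assoc)
qed

text \<open>With \<open>s\<close> the join of \<open>x\<close> and \<open>y\<close>, and \<open>q = -y + s\<close>, one has
  \<open>-x + (y + c) = (-x + s) + (-q + c)\<close>, so the number of summands does not grow.\<close>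

lemma sum_subtract_interval:
  "\<lbrakk>b \<leadsto> b'; x \<in> carrier (Gamma G v); x \<preceq> b\<rbrakk> \<Longrightarrow> inv x \<otimes> b \<leadsto> inv\<^bsub>G'\<^esub> f x \<otimes>\<^bsub>G'\<^esub> b'"
proof (induction arbitrary: x rule: interval_sum.induct)
  case zero
  then have "x = \<one>" by (auto intro: G.lle_antisym)
  then show ?case by (simp add: f_one interval_sum.zero)
next
  case (add y c c')
  note y = add.hyps(1) and x = add.prems and c = sum_closed[OF add.hyps(2)]
  obtain s where s: "s \<in> carrier G" "x \<preceq> s" "y \<preceq> s"
    "\<And>z. \<lbrakk>z \<in> carrier G; x \<preceq> z; y \<preceq> z\<rbrakk> \<Longrightarrow> s \<preceq> z"
    using G.obtain_sup[of x y] x y by auto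
  have s_int: "s \<in> carrier (Gamma G v)"
    using s x y by (auto intro: G.lle_trans[of \<one> x s])
  have "s \<preceq> y \<otimes> c"
    using s(4)[of "y \<otimes> c"] x y c by simp
  then have q_le: "inv y \<otimes> s \<preceq> c"
    using s y c by (simp add: G.inv_mult_le_iff)
  have "inv (inv y \<otimes> s) \<otimes> c \<leadsto> inv\<^bsub>G'\<^esub> f (inv y \<otimes> s) \<otimes>\<^bsub>G'\<^esub> c'"
    using add.IH[OF f_diff(1)[OF y s_int s(3)] q_le] .
  from interval_sum.add[OF f_diff(1)[OF x(1) s_int s(2)] this]
  show ?case
    using x y s c f_Gamma[OF x(1)] f_Gamma[OF y] f_Gamma[OF s_int]
    by (simp add: f_diff[OF x(1) s_int] f_diff[OF y s_int] G.inv_mult_group G'.inv_mult_group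
        G.m_assoc G'.m_assoc)
qed

text \<open>The summands of \<open>a\<close> are removed one at a time from the left, as
  \<open>-(y + c) + b = -c + (-y + b)\<close>.\<close>

lemma sum_subtract:
  "\<lbrakk>a \<leadsto> a'; b \<leadsto> b'; a \<preceq> b\<rbrakk> \<Longrightarrow> inv a \<otimes> b \<leadsto> inv\<^bsub>G'\<^esub> a' \<otimes>\<^bsub>G'\<^esub> b'"
proof (induction arbitrary: b b' rule: interval_sum.induct)
  case zero
  then show ?case using sum_closed[of b b'] by simp
next
  case (add y c c')
  note y = add.hyps(1) and c = sum_closed[OF add.hyps(2)] and b = sum_closed[OF add.prems(1)]
  have "y \<preceq> b"
    using y c b add.prems(2) by (auto intro: G.lle_trans[of y "y \<otimes> c" b])
  moreover have "c \<preceq> inv y \<otimes> b"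
    using y c b add.prems(2) by (simp add: G.inv_mult_le_iff)
  ultimately show ?case
    using add.IH[OF sum_subtract_interval[OF add.prems(1) y]] y c b f_Gamma[OF y]
    by (simp add: G.inv_mult_group G'.inv_mult_group G.m_assoc G'.m_assoc)
qed

text \<open>The difference \<open>-a + b\<close> is a sum again, so its image is a sum of
  nonnegative elements.\<close>

lemma sum_le_imp:
  assumes "a \<leadsto> a'" "b \<leadsto> b'" "a \<preceq> b"
  shows "a' \<preceq>\<^bsub>G'\<^esub> b'"
  using sum_closed(4)[OF sum_subtract[OF assms]] sum_closed[OF assms(1)] sum_closed[OF assms(2)]
  by (simp add: G'.inv_mult_le_iff)

lemma sum_le_iff:
  assumes "a \<leadsto> a'" "b \<leadsto> b'"
  shows "a \<preceq> b \<longleftrightarrow> a' \<preceq>\<^bsub>G'\<^esub> b'"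
  using sum_le_imp[OF assms]
    gamma_iso.sum_le_imp[OF inverse_iso sum_inverse[OF assms(1)] sum_inverse[OF assms(2)]]
  by blast

lemma sum_unique: "\<lbrakk>a \<leadsto> a'; a \<leadsto> b'\<rbrakk> \<Longrightarrow> a' = b'"
  using sum_le_iff[of a a' a b'] sum_le_iff[of a b' a a'] sum_closed[of a a'] sum_closed[of a b']
  by (auto intro: G'.lle_antisym)

text \<open>Split off the meet of \<open>b\<close> and \<open>v\<close>: it is one interval element,
  and what remains lies below a power smaller by one.\<close>

lemma sum_total_power:
  "\<lbrakk>b \<in> carrier G; \<one> \<preceq> b; b \<preceq> v [^] (n::nat)\<rbrakk> \<Longrightarrow> \<exists>b'. b \<leadsto> b'"
proof (induction n arbitrary: b)
  case 0
  then have "b = \<one>" by (auto intro: G.lle_antisym)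
  then show ?case using interval_sum.zero[of G v G' f] by auto
next
  case (Suc n)
  have "\<one> \<preceq> v [^] n"
    by (induction n) (simp_all add: G.mult_nonneg)
  let ?m = "b \<sqinter>\<^bsub>lgroup_order G\<^esub> v"
  have m: "?m \<in> carrier G" "?m \<preceq> b" "?m \<preceq> v" "\<one> \<preceq> ?m"
    using G.meet_lle[of b v] G.lle_meet[of \<one> b v] Suc.prems by auto
  \<comment> \<open>With \<open>nv\<close> nonnegative, this puts \<open>b - nv\<close> below both
    \<open>b\<close> and \<open>v\<close>, hence below their meet.\<close>
  have "b \<preceq> v \<otimes> v [^] n"
    using Suc.prems G.nat_pow_Suc2[of v n] G.unit_closed by simp
  with \<open>\<one> \<preceq> v [^] n\<close> have "b \<otimes> inv (v [^] n) \<preceq> ?m"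
    using Suc.prems(1) by (intro G.lle_meet) (simp_all add: G.inv_mult_le_iff)
  then have "inv ?m \<otimes> b \<preceq> v [^] n"
    using Suc.prems m by (simp add: G.inv_mult_le_iff)
  moreover have "\<one> \<preceq> inv ?m \<otimes> b"
    using Suc.prems m by (simp add: G.inv_mult_le_iff)
  ultimately obtain c' where "inv ?m \<otimes> b \<leadsto> c'"
    using Suc.IH[of "inv ?m \<otimes> b"] Suc.prems m by auto
  then show ?case
    using interval_sum.add[of ?m G v G' f "inv ?m \<otimes> b" c'] m Suc.prems by auto
qed

lemma sum_total: "\<lbrakk>b \<in> carrier G; \<one> \<preceq> b\<rbrakk> \<Longrightarrow> \<exists>b'. b \<leadsto> b'"
  using sum_total_power G.unit_strong by blast

lemma sum_interval: "x \<in> carrier (Gamma G v) \<Longrightarrow> x \<leadsto> f x"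
  using interval_sum.add[OF _ interval_sum.zero, of x G v G' f] f_Gamma[of x] by simp

section \<open>Differences of sums\<close>

abbreviation ext_rel (infix \<open>\<hookrightarrow>\<close> 50) where
  "g \<hookrightarrow> g' \<equiv> extension G v G' f g g'"

lemma ext_closed: "g \<hookrightarrow> g' \<Longrightarrow> g \<in> carrier G" "g \<hookrightarrow> g' \<Longrightarrow> g' \<in> carrier G'"
  unfolding extension_def using sum_closed by auto

text \<open>The noncommutative way to a common denominator: both elements are completed on the left
  to an upper bound \<open>s\<close>, and the two complements are nonnegative, hence sums.\<close>

lemma common_left_multiple:
  assumes "a \<in> carrier G" "b \<in> carrier G"
  obtains p q p' q' where "p \<leadsto> p'" "q \<leadsto> q'" "p \<otimes> a = q \<otimes> b"
proof -
  obtain s where s: "s \<in> carrier G" "a \<preceq> s" "b \<preceq> s"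
    using G.obtain_sup[OF assms] by metis
  then obtain p' q' where "s \<otimes> inv a \<leadsto> p'" "s \<otimes> inv b \<leadsto> q'"
    using sum_total[of "s \<otimes> inv a"] sum_total[of "s \<otimes> inv b"] assms
    by (auto simp: G.inv_mult_le_iff)
  then show thesis
    using that[of "s \<otimes> inv a" p' "s \<otimes> inv b" q'] assms s by (simp add: G.m_assoc)
qed

text \<open>Left factors \<open>p\<close> and \<open>q\<close> with \<open>p + a = q + c\<close> do
  not change the quotients but give them the same denominator, after which the numerators can be
  compared as sums.\<close>

lemma ext_le_iff:
  assumes "g \<hookrightarrow> g'" "h \<hookrightarrow> h'"
  shows "g \<preceq> h \<longleftrightarrow> g' \<preceq>\<^bsub>G'\<^esub> h'"
proof -
  obtain a a' b b' where ab: "a \<leadsto> a'" "b \<leadsto> b'" "g = inv a \<otimes> b" "g' = inv\<^bsub>G'\<^esub> a' \<otimes>\<^bsub>G'\<^esub> b'"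
    using assms(1) unfolding extension_def by blast
  obtain c c' d d' where cd: "c \<leadsto> c'" "d \<leadsto> d'" "h = inv c \<otimes> d" "h' = inv\<^bsub>G'\<^esub> c' \<otimes>\<^bsub>G'\<^esub> d'"
    using assms(2) unfolding extension_def by blast
  note cl = sum_closed[OF ab(1)] sum_closed[OF ab(2)] sum_closed[OF cd(1)] sum_closed[OF cd(2)]
  obtain p q p' q' where pq: "p \<leadsto> p'" "q \<leadsto> q'" "p \<otimes> a = q \<otimes> c"
    using common_left_multiple[of a c] cl by metis
  note cl = cl sum_closed[OF pq(1)] sum_closed[OF pq(2)]
  have pq': "p' \<otimes>\<^bsub>G'\<^esub> a' = q' \<otimes>\<^bsub>G'\<^esub> c'"
    using sum_unique sum_mult[OF pq(1) ab(1)] sum_mult[OF pq(2) cd(1)] pq(3) by simp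
  have "inv a \<otimes> b = inv (p \<otimes> a) \<otimes> (p \<otimes> b)" "inv c \<otimes> d = inv (q \<otimes> c) \<otimes> (q \<otimes> d)"
    using cl by (simp_all add: G.inv_mult_group G.m_assoc)
  then have 1: "g \<preceq> h \<longleftrightarrow> p \<otimes> b \<preceq> q \<otimes> d"
    using cl ab(3) cd(3) pq(3) by simp
  have "inv\<^bsub>G'\<^esub> a' \<otimes>\<^bsub>G'\<^esub> b' = inv\<^bsub>G'\<^esub> (p' \<otimes>\<^bsub>G'\<^esub> a') \<otimes>\<^bsub>G'\<^esub> (p' \<otimes>\<^bsub>G'\<^esub> b')"
    "inv\<^bsub>G'\<^esub> c' \<otimes>\<^bsub>G'\<^esub> d' = inv\<^bsub>G'\<^esub> (q' \<otimes>\<^bsub>G'\<^esub> c') \<otimes>\<^bsub>G'\<^esub> (q' \<otimes>\<^bsub>G'\<^esub> d')"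
    using cl by (simp_all add: G'.inv_mult_group G'.m_assoc)
  then have "g' \<preceq>\<^bsub>G'\<^esub> h' \<longleftrightarrow> p' \<otimes>\<^bsub>G'\<^esub> b' \<preceq>\<^bsub>G'\<^esub> q' \<otimes>\<^bsub>G'\<^esub> d'"
    using cl ab(4) cd(4) pq' by simp
  then show ?thesis
    using 1 sum_le_iff[OF sum_mult[OF pq(1) ab(2)] sum_mult[OF pq(2) cd(2)]] by simp
qed

text \<open>In \<open>(-a + b) + (-c + d)\<close> the inner terms must cancel, so the common
  multiple is taken of \<open>b\<close> and \<open>c\<close>; the result is
  \<open>-(p + a) + (q + d)\<close>.\<close>

lemma ext_mult:
  assumes "g \<hookrightarrow> g'" "h \<hookrightarrow> h'"
  shows "g \<otimes> h \<hookrightarrow> g' \<otimes>\<^bsub>G'\<^esub> h'"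
proof -
  obtain a a' b b' where ab: "a \<leadsto> a'" "b \<leadsto> b'" "g = inv a \<otimes> b" "g' = inv\<^bsub>G'\<^esub> a' \<otimes>\<^bsub>G'\<^esub> b'"
    using assms(1) unfolding extension_def by blast
  obtain c c' d d' where cd: "c \<leadsto> c'" "d \<leadsto> d'" "h = inv c \<otimes> d" "h' = inv\<^bsub>G'\<^esub> c' \<otimes>\<^bsub>G'\<^esub> d'"
    using assms(2) unfolding extension_def by blast
  note cl = sum_closed[OF ab(1)] sum_closed[OF ab(2)] sum_closed[OF cd(1)] sum_closed[OF cd(2)]
  obtain p q p' q' where pq: "p \<leadsto> p'" "q \<leadsto> q'" "p \<otimes> b = q \<otimes> c"
    using common_left_multiple[of b c] cl by metis
  note cl = cl sum_closed[OF pq(1)] sum_closed[OF pq(2)]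
  have pq': "p' \<otimes>\<^bsub>G'\<^esub> b' = q' \<otimes>\<^bsub>G'\<^esub> c'"
    using sum_unique sum_mult[OF pq(1) ab(2)] sum_mult[OF pq(2) cd(1)] pq(3) by simp
  have "b = inv p \<otimes> (q \<otimes> c)"
    using cl by (simp flip: pq(3))
  then have 1: "g \<otimes> h = inv (p \<otimes> a) \<otimes> (q \<otimes> d)"
    using cl ab(3) cd(3) by (simp add: G.inv_mult_group G.m_assoc)
  have "b' = inv\<^bsub>G'\<^esub> p' \<otimes>\<^bsub>G'\<^esub> (q' \<otimes>\<^bsub>G'\<^esub> c')"
    using cl by (simp flip: pq')
  then have "g' \<otimes>\<^bsub>G'\<^esub> h' = inv\<^bsub>G'\<^esub> (p' \<otimes>\<^bsub>G'\<^esub> a') \<otimes>\<^bsub>G'\<^esub> (q' \<otimes>\<^bsub>G'\<^esub> d')"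
    using cl ab(4) cd(4) by (simp add: G'.inv_mult_group G'.m_assoc)
  then show ?thesis
    unfolding extension_def using 1 sum_mult[OF pq(1) ab(1)] sum_mult[OF pq(2) cd(2)] by blast
qed

lemma ext_total: "g \<in> carrier G \<Longrightarrow> \<exists>g'. g \<hookrightarrow> g'"
proof -
  assume g: "g \<in> carrier G"
  obtain a where a: "a \<in> carrier G" "\<one> \<preceq> a" "\<one> \<preceq> a \<otimes> g"
    using G.obtain_nonneg_quotient[OF g] .
  then obtain a' b' where ab: "a \<leadsto> a'" "a \<otimes> g \<leadsto> b'"
    using sum_total g by blast
  have "g = inv a \<otimes> (a \<otimes> g)" using a g by simp
  then have "g \<hookrightarrow> inv\<^bsub>G'\<^esub> a' \<otimes>\<^bsub>G'\<^esub> b'"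
    unfolding extension_def using ab by blast
  then show ?thesis ..
qed

lemma sum_inverse_imp:
  assumes "interval_sum G' v' G (inv_into (carrier (Gamma G v)) f) a' a"
  shows "a \<leadsto> a'"
  using assms
proof induction
  case (add y' c' c)
  let ?y = "inv_into (carrier (Gamma G v)) f y'"
  have "y' \<in> f ` carrier (Gamma G v)"
    using add.hyps(1) pmv_isoD(1)[OF iso] by (simp add: bij_betw_def)
  then have "?y \<in> carrier (Gamma G v)" "f ?y = y'"
    by (rule inv_into_into, rule f_inv_into_f)
  then show ?case
    using interval_sum.add[of ?y G v G' f c c'] add.IH by simp
qed (rule interval_sum.zero)

lemma ext_surj:
  assumes "g' \<in> carrier G'"
  shows "\<exists>g. g \<hookrightarrow> g'"
proof -
  let ?F = "inv_into (carrier (Gamma G v)) f"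
  obtain a' a b' b where
    "interval_sum G' v' G ?F a' a" "interval_sum G' v' G ?F b' b" "g' = inv\<^bsub>G'\<^esub> a' \<otimes>\<^bsub>G'\<^esub> b'"
    using gamma_iso.ext_total[OF inverse_iso assms] unfolding extension_def by blast
  then have "inv a \<otimes> b \<hookrightarrow> g'"
    using sum_inverse_imp[of a' a] sum_inverse_imp[of b' b] unfolding extension_def by blast
  then show ?thesis ..
qed

lemma ext_unique:
  assumes "g \<hookrightarrow> g'" "g \<hookrightarrow> h'"
  shows "g' = h'"
  using ext_le_iff[OF assms] ext_le_iff[OF assms(2,1)] ext_closed[OF assms(1)] ext_closed[OF assms(2)]
  by (simp add: G'.lle_antisym)

theorem gamma_iso_extends:
  "\<exists>F \<in> lgroup_iso G G'. \<forall>x \<in> carrier (Gamma G v). F x = f x"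
proof -
  define F where "F g = (THE g'. g \<hookrightarrow> g')" for g
  have F_eq: "F g = g'" if "g \<hookrightarrow> g'" for g g'
    using that ext_unique unfolding F_def by blast
  have F_ext: "g \<hookrightarrow> F g" if "g \<in> carrier G" for g
    using F_eq ext_total[OF that] by auto
  have le: "F g \<preceq>\<^bsub>G'\<^esub> F h \<longleftrightarrow> g \<preceq> h" if "g \<in> carrier G" "h \<in> carrier G" for g h
    using ext_le_iff F_ext that by blast
  have closed: "F g \<in> carrier G'" if "g \<in> carrier G" for g
    using ext_closed(2)[OF F_ext[OF that]] .
  have "F \<in> hom G G'"
    using F_eq[OF ext_mult[OF F_ext F_ext]] closed by (simp add: hom_def)
  moreover have "inj_on F (carrier G)"
  proof (rule inj_onI)
    fix x y assume "x \<in> carrier G" "y \<in> carrier G" "F x = F y"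
    then show "x = y" using le[of x y] le[of y x] closed by (auto intro: G.lle_antisym)
  qed
  moreover have "F ` carrier G = carrier G'"
  proof
    show "carrier G' \<subseteq> F ` carrier G"
    proof
      fix g' assume "g' \<in> carrier G'"
      then obtain g where "g \<hookrightarrow> g'" using ext_surj by blast
      then show "g' \<in> F ` carrier G"
        using F_eq[of g g'] ext_closed(1)[of g g'] by auto
    qed
  qed (use closed in auto)
  moreover have "F x = f x" if "x \<in> carrier (Gamma G v)" for x
  proof (rule F_eq)
    \<comment> \<open>An interval element is the difference of itself and the empty sum.\<close>
    show "x \<hookrightarrow> f x"
      unfolding extension_def using interval_sum.zero[of G v G' f] sum_interval[OF that] f_Gamma[OF that] that
      by (intro exI[of _ \<one>] exI[of _ "\<one>\<^bsub>G'\<^esub>"] exI[of _ x] exI[of _ "f x"]) simp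
  qed
  ultimately show ?thesis
    by (intro bexI[of _ F]) (simp_all add: le lgroup_iso_def iso_def bij_betw_def)
qed

end

section \<open>Lexicographic products\<close>

lemma lex_prod_sel [simp]:
  "carrier (lex_prod H G) = carrier H \<times> carrier G"
  "(h, g) \<otimes>\<^bsub>lex_prod H G\<^esub> (h', g') = (h \<otimes>\<^bsub>H\<^esub> h', g \<otimes>\<^bsub>G\<^esub> g')"
  "\<one>\<^bsub>lex_prod H G\<^esub> = (\<one>\<^bsub>H\<^esub>, \<one>\<^bsub>G\<^esub>)"
  "(h, g) \<preceq>\<^bsub>lex_prod H G\<^esub> (h', g') \<longleftrightarrow>
    h \<preceq>\<^bsub>H\<^esub> h' \<and> h \<noteq> h' \<or> h = h' \<and> g \<preceq>\<^bsub>G\<^esub> g'"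
  by (simp_all add: lex_prod_def DirProd_def)

context linear_abelian_unital_lgroup
begin

lemma lle_total: "\<lbrakk>x \<in> carrier G; y \<in> carrier G\<rbrakk> \<Longrightarrow> x \<preceq> y \<or> y \<preceq> x"
  using total_order_total by simp

lemma trivial_of_unit_one:
  assumes "u = \<one>" "x \<in> carrier G"
  shows "x = \<one>"
  using unit_strong[OF assms(2)] assms by (auto intro: lle_antisym)

end

locale lex_product = H: linear_abelian_unital_lgroup H u + G: lgroup G
  for H :: "('h, 'm) lgroup_scheme" (structure) and u and G :: "('g, 'n) lgroup_scheme" (structure)
begin

lemma group_lex: "group (lex_prod H G)"
proof (rule groupI)
  fix x assume "x \<in> carrier (lex_prod H G)"
  then show "\<exists>y \<in> carrier (lex_prod H G). y \<otimes>\<^bsub>lex_prod H G\<^esub> x = \<one>\<^bsub>lex_prod H G\<^esub>"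
    by (cases x) (auto intro!: bexI[of _ "(inv\<^bsub>H\<^esub> fst x, inv\<^bsub>G\<^esub> snd x)"])
qed (auto simp: H.m_assoc G.m_assoc)

sublocale L: lgroup "lex_prod H G"
proof (rule lgroupI[OF group_lex])
  fix x y assume xy: "x \<in> carrier (lex_prod H G)" "y \<in> carrier (lex_prod H G)"
  obtain h g h' g' where eq: "x = (h, g)" "y = (h', g')" by (cases x, cases y)
  obtain s where s: "s \<in> carrier G" "g \<preceq>\<^bsub>G\<^esub> s" "g' \<preceq>\<^bsub>G\<^esub> s"
    "\<And>z. \<lbrakk>z \<in> carrier G; g \<preceq>\<^bsub>G\<^esub> z; g' \<preceq>\<^bsub>G\<^esub> z\<rbrakk> \<Longrightarrow> s \<preceq>\<^bsub>G\<^esub> z"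
    using G.obtain_sup[of g g'] xy eq by auto
  \<comment> \<open>As \<open>H\<close> is linearly ordered, elements of different layers are
    comparable and the larger one is the join; only within a layer does the join of \<open>G\<close>
    enter.\<close>
  consider "h = h'" | "h \<noteq> h'" "h \<preceq>\<^bsub>H\<^esub> h'" | "h \<noteq> h'" "h' \<preceq>\<^bsub>H\<^esub> h"
    using H.lle_total[of h h'] xy eq by auto
  then show "\<exists>s \<in> carrier (lex_prod H G). x \<preceq>\<^bsub>lex_prod H G\<^esub> s \<and> y \<preceq>\<^bsub>lex_prod H G\<^esub> s \<and>
    (\<forall>z \<in> carrier (lex_prod H G).
      x \<preceq>\<^bsub>lex_prod H G\<^esub> z \<and> y \<preceq>\<^bsub>lex_prod H G\<^esub> z \<longrightarrow> s \<preceq>\<^bsub>lex_prod H G\<^esub> z)"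
  proof cases
    case 1
    then show ?thesis using s xy eq by (intro bexI[of _ "(h, s)"]) auto
  next
    case 2
    then show ?thesis using xy eq by (intro bexI[of _ y]) auto
  next
    case 3
    then show ?thesis using xy eq by (intro bexI[of _ x]) auto
  qed
qed (auto intro: H.lle_antisym G.lle_antisym H.lle_trans G.lle_trans dest: H.lle_antisym)

lemma lex_fst_mono:
  assumes "k \<in> carrier (lex_prod H G)" "k' \<in> carrier (lex_prod H G)" "k \<preceq>\<^bsub>lex_prod H G\<^esub> k'"
  shows "fst k \<preceq>\<^bsub>H\<^esub> fst k'"
  using assms by (cases k, cases k') auto

lemma inv_lex [simp]:
  assumes "h \<in> carrier H" "g \<in> carrier G"
  shows "inv\<^bsub>lex_prod H G\<^esub> (h, g) = (inv\<^bsub>H\<^esub> h, inv\<^bsub>G\<^esub> g)"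
  using assms by (intro L.inv_equality) auto

lemma pow_lex:
  assumes "h \<in> carrier H" "g \<in> carrier G"
  shows "(h, g) [^]\<^bsub>lex_prod H G\<^esub> (n::nat) = (h [^]\<^bsub>H\<^esub> n, g [^]\<^bsub>G\<^esub> n)"
  by (induction n) simp_all

end

section \<open>Isomorphisms between lexicographic products over the same \<open>H\<close>\<close>

lemma lgroup_isoD:
  assumes "F \<in> lgroup_iso G G'" "x \<in> carrier G" "y \<in> carrier G"
  shows "F x \<in> carrier G'" "F (x \<otimes>\<^bsub>G\<^esub> y) = F x \<otimes>\<^bsub>G'\<^esub> F y"
    "F x \<preceq>\<^bsub>G'\<^esub> F y \<longleftrightarrow> x \<preceq>\<^bsub>G\<^esub> y" "F x = F y \<longleftrightarrow> x = y"
    "F ` carrier G = carrier G'"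
  using assms by (auto simp: lgroup_iso_def iso_def hom_def bij_betw_def inj_on_def)

lemma lgroup_iso_inv:
  assumes "group G" "F \<in> lgroup_iso G G'"
  shows "inv_into (carrier G) F \<in> lgroup_iso G' G"
    "\<And>x. x \<in> carrier G \<Longrightarrow> inv_into (carrier G) F (F x) = x"
    "\<And>y. y \<in> carrier G' \<Longrightarrow> F (inv_into (carrier G) F y) = y"
proof -
  have F: "F \<in> iso G G'" "inj_on F (carrier G)" "F ` carrier G = carrier G'"
    using assms by (auto simp: lgroup_iso_def iso_def bij_betw_def)
  show "inv_into (carrier G) F (F x) = x" if "x \<in> carrier G" for x
    using F(2) that by (rule inv_into_f_f)
  show r: "F (inv_into (carrier G) F y) = y" if "y \<in> carrier G'" for y
    using F(3) that by (simp add: f_inv_into_f)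
  have "inv_into (carrier G) F y \<in> carrier G" if "y \<in> carrier G'" for y
    using F(3) that by (simp add: inv_into_into)
  then have "x \<preceq>\<^bsub>G'\<^esub> y \<longleftrightarrow> inv_into (carrier G) F x \<preceq>\<^bsub>G\<^esub> inv_into (carrier G) F y"
    if "x \<in> carrier G'" "y \<in> carrier G'" for x y
    using lgroup_isoD(3)[OF assms(2), of "inv_into (carrier G) F x" "inv_into (carrier G) F y"]
      r that by simp
  then show "inv_into (carrier G) F \<in> lgroup_iso G' G"
    using group.iso_set_sym[OF assms(1) F(1)] by (simp add: lgroup_iso_def)
qed

locale lex_iso = D: lex_product H u G + R: lex_product H u G'
  for H :: "('h, 'm) lgroup_scheme" (structure) and u
    and G :: "('g, 'n) lgroup_scheme" (structure) and G' :: "('k, 'l) lgroup_scheme" (structure) +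
  fixes F
  assumes F: "F \<in> lgroup_iso (lex_prod H G) (lex_prod H G')"
begin

lemma inverse_lex_iso: "lex_iso H u G' G (inv_into (carrier (lex_prod H G)) F)"
  using lgroup_iso_inv(1)[OF D.group_lex F] D.lex_product_axioms R.lex_product_axioms
  by (simp add: lex_iso_def lex_iso_axioms_def)

lemma F_closed:
  assumes "k \<in> carrier (lex_prod H G)"
  shows "F k \<in> carrier (lex_prod H G')" "fst (F k) \<in> carrier H" "snd (F k) \<in> carrier G'"
  using lgroup_isoD(1)[OF F assms assms] by auto

lemma F_mult:
  assumes "k \<in> carrier (lex_prod H G)" "k' \<in> carrier (lex_prod H G)"
  shows "fst (F (k \<otimes>\<^bsub>lex_prod H G\<^esub> k')) = fst (F k) \<otimes>\<^bsub>H\<^esub> fst (F k')"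
    "snd (F (k \<otimes>\<^bsub>lex_prod H G\<^esub> k')) = snd (F k) \<otimes>\<^bsub>G'\<^esub> snd (F k')"
  using lgroup_isoD(2)[OF F assms] by (cases "F k", cases "F k'", simp)+

text \<open>\<open>F\<close> matches the two bottom layers, and these are copies of \<open>G\<close>
  and \<open>G'\<close>. The implication from right to left in \<open>kernel\<close> makes the
  restriction surjective.\<close>

lemma isomorphic_of_kernel:
  assumes kernel: "\<And>k. k \<in> carrier (lex_prod H G) \<Longrightarrow> fst k = \<one>\<^bsub>H\<^esub> \<longleftrightarrow> fst (F k) = \<one>\<^bsub>H\<^esub>"
  shows "lgroup_isomorphic G G'"
proof -
  define e where "e g = snd (F (\<one>\<^bsub>H\<^esub>, g))" for g
  have e: "F (\<one>\<^bsub>H\<^esub>, g) = (\<one>\<^bsub>H\<^esub>, e g)" "e g \<in> carrier G'" if "g \<in> carrier G" for g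
    using kernel[of "(\<one>\<^bsub>H\<^esub>, g)"] F_closed[of "(\<one>\<^bsub>H\<^esub>, g)"] that by (auto simp: e_def prod_eq_iff)
  have mult: "e (g \<otimes>\<^bsub>G\<^esub> h) = e g \<otimes>\<^bsub>G'\<^esub> e h" if "g \<in> carrier G" "h \<in> carrier G" for g h
    using F_mult(2)[of "(\<one>\<^bsub>H\<^esub>, g)" "(\<one>\<^bsub>H\<^esub>, h)"] that by (simp add: e_def)
  have le: "e g \<preceq>\<^bsub>G'\<^esub> e h \<longleftrightarrow> g \<preceq>\<^bsub>G\<^esub> h" if "g \<in> carrier G" "h \<in> carrier G" for g h
    using lgroup_isoD(3)[OF F, of "(\<one>\<^bsub>H\<^esub>, g)" "(\<one>\<^bsub>H\<^esub>, h)"] that by (simp add: e)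
  have inj: "inj_on e (carrier G)"
  proof (rule inj_onI)
    fix x y assume "x \<in> carrier G" "y \<in> carrier G" "e x = e y"
    then show "x = y" using le[of x y] le[of y x] e(2) by (auto intro: D.G.lle_antisym)
  qed
  have "\<exists>g \<in> carrier G. e g = g'" if "g' \<in> carrier G'" for g'
  proof -
    have "(\<one>\<^bsub>H\<^esub>, g') \<in> F ` carrier (lex_prod H G)"
      using lgroup_isoD(5)[OF F D.L.one_closed D.L.one_closed] that by simp
    then obtain k where k: "k \<in> carrier (lex_prod H G)" "F k = (\<one>\<^bsub>H\<^esub>, g')" by auto
    then have "k = (\<one>\<^bsub>H\<^esub>, snd k)" using kernel[of k] by (simp add: prod_eq_iff)
    then show ?thesis using k e_def by (metis SigmaE lex_prod_sel(1) snd_conv)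
  qed
  then have "e ` carrier G = carrier G'" using e(2) by force
  then have "e \<in> lgroup_iso G G'"
    using e(2) mult le inj by (auto simp: lgroup_iso_def iso_def hom_def bij_betw_def)
  then show ?thesis unfolding lgroup_isomorphic_def by blast
qed

text \<open>If \<open>u\<close> is not zero, every nonnegative element of the bottom layer lies
  strictly below \<open>(u, b)\<close>, and such elements generate the layer, so information about
  the unit interval suffices. If \<open>u\<close> is zero, \<open>H\<close> is trivial.\<close>

lemma kernel_of_bottom:
  assumes bottom: "\<And>k. \<lbrakk>k \<in> carrier (Gamma (lex_prod H G) (u, b)); fst k = \<one>\<^bsub>H\<^esub>\<rbrakk>
      \<Longrightarrow> fst (F k) = \<one>\<^bsub>H\<^esub>"
    and k: "k \<in> carrier (lex_prod H G)" "fst k = \<one>\<^bsub>H\<^esub>"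
  shows "fst (F k) = \<one>\<^bsub>H\<^esub>"
proof (cases "u = \<one>\<^bsub>H\<^esub>")
  case True
  then show ?thesis
    using D.H.trivial_of_unit_one F_closed(2)[OF k(1)] by simp
next
  case False
  obtain g where g: "k = (\<one>\<^bsub>H\<^esub>, g)" "g \<in> carrier G" using k by (cases k) auto
  obtain a where a: "a \<in> carrier G" "\<one>\<^bsub>G\<^esub> \<preceq>\<^bsub>G\<^esub> a" "\<one>\<^bsub>G\<^esub> \<preceq>\<^bsub>G\<^esub> a \<otimes>\<^bsub>G\<^esub> g"
    using D.G.obtain_nonneg_quotient[OF g(2)] .
  have "fst (F (\<one>\<^bsub>H\<^esub>, c)) = \<one>\<^bsub>H\<^esub>" if "c \<in> carrier G" "\<one>\<^bsub>G\<^esub> \<preceq>\<^bsub>G\<^esub> c" for c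
    using that False D.H.unit_nonneg by (intro bottom) auto
  then show ?thesis
    using F_mult(1)[of "(\<one>\<^bsub>H\<^esub>, a)" "(\<one>\<^bsub>H\<^esub>, g)"] F_closed(2)[of "(\<one>\<^bsub>H\<^esub>, g)"] a g by simp
qed

text \<open>As \<open>F\<close> sends the bottom layer into the bottom layer, the first coordinate
  of \<open>F (h, g)\<close> is independent of \<open>g\<close>. The resulting map \<open>q\<close>
  of \<open>H\<close> onto itself preserves order and fixes \<open>u\<close>; its injectivity is the
  remaining implication.\<close>

lemma kernel_of_hopfian:
  assumes hopf: "hopfian H u"
    and unit: "F (u, b) = (u, b')" "b \<in> carrier G"
    and kernel: "\<And>k. \<lbrakk>k \<in> carrier (lex_prod H G); fst k = \<one>\<^bsub>H\<^esub>\<rbrakk> \<Longrightarrow> fst (F k) = \<one>\<^bsub>H\<^esub>"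
    and k: "k \<in> carrier (lex_prod H G)"
  shows "fst k = \<one>\<^bsub>H\<^esub> \<longleftrightarrow> fst (F k) = \<one>\<^bsub>H\<^esub>"
proof
  define q where "q h = fst (F (h, \<one>\<^bsub>G\<^esub>))" for h
  have q: "fst (F (h, g)) = q h" if "h \<in> carrier H" "g \<in> carrier G" for h g
    using F_mult(1)[of "(h, \<one>\<^bsub>G\<^esub>)" "(\<one>\<^bsub>H\<^esub>, g)"] kernel[of "(\<one>\<^bsub>H\<^esub>, g)"]
      F_closed(2)[of "(h, \<one>\<^bsub>G\<^esub>)"] that by (simp add: q_def)
  have closed: "q h \<in> carrier H" if "h \<in> carrier H" for h
    using F_closed(2) that by (simp add: q_def)
  have "q \<in> hom H H"
    using closed F_mult(1)[of "(_, \<one>\<^bsub>G\<^esub>)" "(_, \<one>\<^bsub>G\<^esub>)"] by (auto simp: hom_def q_def)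
  moreover have "q x \<preceq>\<^bsub>H\<^esub> q y" if "x \<in> carrier H" "y \<in> carrier H" "x \<preceq>\<^bsub>H\<^esub> y" for x y
    using lgroup_isoD(3)[OF F, of "(x, \<one>\<^bsub>G\<^esub>)" "(y, \<one>\<^bsub>G\<^esub>)"] R.lex_fst_mono F_closed(1) that
    unfolding q_def by auto
  moreover have "q u = u"
    using q[of u b] unit D.H.unit_closed by simp
  moreover have "q ` carrier H = carrier H"
  proof
    show "carrier H \<subseteq> q ` carrier H"
    proof
      fix h assume "h \<in> carrier H"
      then have "(h, \<one>\<^bsub>G'\<^esub>) \<in> F ` carrier (lex_prod H G)"
        using lgroup_isoD(5)[OF F D.L.one_closed D.L.one_closed] by simp
      then obtain h' g where "h' \<in> carrier H" "g \<in> carrier G" "F (h', g) = (h, \<one>\<^bsub>G'\<^esub>)" by auto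
      then show "h \<in> q ` carrier H" using q[of h' g] by (auto simp: image_iff)
    qed
  qed (use closed in auto)
  ultimately have "inj_on q (carrier H)"
    using hopf unfolding hopfian_def by blast
  moreover have "q \<one>\<^bsub>H\<^esub> = \<one>\<^bsub>H\<^esub>"
    using kernel[of "(\<one>\<^bsub>H\<^esub>, \<one>\<^bsub>G\<^esub>)"] by (simp add: q_def)
  moreover assume "fst (F k) = \<one>\<^bsub>H\<^esub>"
  then have "q (fst k) = \<one>\<^bsub>H\<^esub>"
    using q[of "fst k" "snd k"] k by auto
  ultimately show "fst k = \<one>\<^bsub>H\<^esub>"
    using k inj_onD[of q "carrier H" "fst k" "\<one>\<^bsub>H\<^esub>"] by auto
qed (use kernel k in auto)

text \<open>The kernels of two order-preserving homomorphisms onto linearly ordered groups need not be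
  comparable, but here one of them is the bottom layer of a lexicographic product: a convex subgroup
  either lies in it or contains it.\<close>

lemma kernels_comparable:
  "(\<forall>k \<in> carrier (lex_prod H G). fst k = \<one>\<^bsub>H\<^esub> \<longrightarrow> fst (F k) = \<one>\<^bsub>H\<^esub>) \<or>
   (\<forall>k \<in> carrier (lex_prod H G). fst (F k) = \<one>\<^bsub>H\<^esub> \<longrightarrow> fst k = \<one>\<^bsub>H\<^esub>)"
proof (rule disjCI)
  assume "\<not> (\<forall>k \<in> carrier (lex_prod H G). fst (F k) = \<one>\<^bsub>H\<^esub> \<longrightarrow> fst k = \<one>\<^bsub>H\<^esub>)"
  then obtain k0 where k0: "k0 \<in> carrier (lex_prod H G)" "fst (F k0) = \<one>\<^bsub>H\<^esub>" "fst k0 \<noteq> \<one>\<^bsub>H\<^esub>"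
    by blast
  have one: "fst (F (\<one>\<^bsub>H\<^esub>, \<one>\<^bsub>G\<^esub>)) = \<one>\<^bsub>H\<^esub>"
    using F_mult(1)[of "(\<one>\<^bsub>H\<^esub>, \<one>\<^bsub>G\<^esub>)" "(\<one>\<^bsub>H\<^esub>, \<one>\<^bsub>G\<^esub>)"] F_closed(2)[of "(\<one>\<^bsub>H\<^esub>, \<one>\<^bsub>G\<^esub>)"] by simp
  have ik0: "inv\<^bsub>lex_prod H G\<^esub> k0 \<in> carrier (lex_prod H G)" "fst (F (inv\<^bsub>lex_prod H G\<^esub> k0)) = \<one>\<^bsub>H\<^esub>"
    "fst (inv\<^bsub>lex_prod H G\<^esub> k0) = inv\<^bsub>H\<^esub> fst k0"
    using F_mult(1)[of k0 "inv\<^bsub>lex_prod H G\<^esub> k0"] F_closed(2)[of "inv\<^bsub>lex_prod H G\<^esub> k0"] k0 one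
    by auto
  have "\<exists>p \<in> carrier (lex_prod H G). fst (F p) = \<one>\<^bsub>H\<^esub> \<and> \<one>\<^bsub>H\<^esub> \<preceq>\<^bsub>H\<^esub> fst p \<and> fst p \<noteq> \<one>\<^bsub>H\<^esub>"
  proof (cases "\<one>\<^bsub>H\<^esub> \<preceq>\<^bsub>H\<^esub> fst k0")
    case False
    then have "\<one>\<^bsub>H\<^esub> \<preceq>\<^bsub>H\<^esub> inv\<^bsub>H\<^esub> fst k0"
      using D.H.lle_total[of "\<one>\<^bsub>H\<^esub>" "fst k0"] k0(1) by auto
    moreover have "inv\<^bsub>H\<^esub> fst k0 \<noteq> \<one>\<^bsub>H\<^esub>"
      using k0 by (metis D.H.inv_inv D.H.inv_one SigmaE fst_conv lex_prod_sel(1))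
    ultimately show ?thesis using ik0 by metis
  qed (use k0 in blast)
  then obtain p where p: "p \<in> carrier (lex_prod H G)" "fst (F p) = \<one>\<^bsub>H\<^esub>" "\<one>\<^bsub>H\<^esub> \<preceq>\<^bsub>H\<^esub> fst p" "fst p \<noteq> \<one>\<^bsub>H\<^esub>"
    by blast
  \<comment> \<open>Elements of the bottom layer lie below \<open>p\<close>, whose first coordinate
    is positive. As the first coordinate of \<open>F p\<close> is zero, it bounds those of their
    images; the opposite bound comes from inverses.\<close>
  have below: "fst (F k) \<preceq>\<^bsub>H\<^esub> \<one>\<^bsub>H\<^esub>" if "k \<in> carrier (lex_prod H G)" "fst k = \<one>\<^bsub>H\<^esub>" for k
  proof -
    have "k \<preceq>\<^bsub>lex_prod H G\<^esub> p" using p that by (cases k, cases p) auto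
    then show ?thesis
      using R.lex_fst_mono F_closed(1) lgroup_isoD(3)[OF F] p that by metis
  qed
  have "fst (F k) = \<one>\<^bsub>H\<^esub>" if k: "k \<in> carrier (lex_prod H G)" "fst k = \<one>\<^bsub>H\<^esub>" for k
  proof -
    let ?i = "inv\<^bsub>lex_prod H G\<^esub> k"
    have i: "?i \<in> carrier (lex_prod H G)" "fst ?i = \<one>\<^bsub>H\<^esub>" using k by auto
    have "fst (F k) \<otimes>\<^bsub>H\<^esub> fst (F ?i) = \<one>\<^bsub>H\<^esub>"
      using F_mult(1)[OF k(1) i(1)] k one by auto
    then have "inv\<^bsub>H\<^esub> fst (F k) = fst (F ?i)"
      using F_closed(2) k i by (metis D.H.inv_equality D.H.m_comm)
    then have "\<one>\<^bsub>H\<^esub> \<preceq>\<^bsub>H\<^esub> fst (F k)"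
      using below[OF i] F_closed(2)[OF k(1)] by (metis D.H.inv_le_one_iff(1))
    then show ?thesis
      using below[OF k] F_closed(2)[OF k(1)] by (auto intro: D.H.lle_antisym)
  qed
  then show "\<forall>k \<in> carrier (lex_prod H G). fst k = \<one>\<^bsub>H\<^esub> \<longrightarrow> fst (F k) = \<one>\<^bsub>H\<^esub>" by blast
qed

text \<open>Whichever bottom layer is mapped into the other, by \<open>F\<close> or by its inverse,
  the Hopfian property turns inclusion into equality.\<close>

lemma isomorphic_of_hopfian:
  assumes hopf: "hopfian H u" and unit: "F (u, b) = (u, b')" "b \<in> carrier G"
  shows "lgroup_isomorphic G G'"
  using kernels_comparable
proof
  assume "\<forall>k \<in> carrier (lex_prod H G). fst k = \<one>\<^bsub>H\<^esub> \<longrightarrow> fst (F k) = \<one>\<^bsub>H\<^esub>"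
  then show ?thesis
    using kernel_of_hopfian[OF hopf unit] by (intro isomorphic_of_kernel) blast
next
  let ?E = "inv_into (carrier (lex_prod H G)) F"
  interpret E: lex_iso H u G' G ?E by (rule inverse_lex_iso)
  note inv = lgroup_iso_inv[OF D.group_lex F]
  assume "\<forall>k \<in> carrier (lex_prod H G). fst (F k) = \<one>\<^bsub>H\<^esub> \<longrightarrow> fst k = \<one>\<^bsub>H\<^esub>"
  then have ker: "fst (?E k) = \<one>\<^bsub>H\<^esub>" if "k \<in> carrier (lex_prod H G')" "fst k = \<one>\<^bsub>H\<^esub>" for k
    using E.F_closed(1)[OF that(1)] inv(3)[OF that(1)] that(2) by metis
  have "?E (u, b') = (u, b)" "b' \<in> carrier G'"
    using inv(2)[of "(u, b)"] F_closed(3)[of "(u, b)"] unit D.H.unit_closed by auto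
  then have "fst k = \<one>\<^bsub>H\<^esub> \<longleftrightarrow> fst (?E k) = \<one>\<^bsub>H\<^esub>" if "k \<in> carrier (lex_prod H G')" for k
    using E.kernel_of_hopfian[OF hopf] ker that by blast
  then show ?thesis
    using inv(2) F_closed(1) by (intro isomorphic_of_kernel) metis
qed

end

section \<open>Uniqueness of the second factor\<close>

lemma lex_representations_extend:
  assumes H: "linear_abelian_unital_lgroup H u" and M: "pseudo_mv_algebra M"
    and rep: "lex_representation H u M G b \<psi>" and rep': "lex_representation H u M G' b' \<psi>'"
  obtains F where "lex_iso H u G G' F" "\<And>x. x \<in> carrier M \<Longrightarrow> F (\<psi> x) = \<psi>' x"
proof -
  interpret pseudo_mv_algebra M by (rule M)
  have iso: "\<psi> \<in> pmv_iso M (Gamma (lex_prod H G) (u, b))"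
    "\<psi>' \<in> pmv_iso M (Gamma (lex_prod H G') (u, b'))"
    using rep rep' by (simp_all add: lex_representation_def)
  have "inv_into (carrier M) \<psi> \<in> pmv_iso (Gamma (lex_prod H G) (u, b)) M"
    using closed by (intro pmv_iso_inv[OF iso(1)])
  \<comment> \<open>The two representations are compared on unit intervals through
    \<open>\<psi>'\<close> after the inverse of \<open>\<psi>\<close>. Both lexicographic products
    are unital by the definition of a representation, as the extension theorem requires.\<close>
  then have g: "gamma_iso (lex_prod H G) (u, b) (lex_prod H G') (u, b') (\<psi>' \<circ> inv_into (carrier M) \<psi>)"
    using rep rep' pmv_iso_comp[OF _ iso(2)]
    by (auto simp: gamma_iso_def gamma_iso_axioms_def lex_representation_def)
  obtain F where F: "F \<in> lgroup_iso (lex_prod H G) (lex_prod H G')"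
    "\<And>k. k \<in> carrier (Gamma (lex_prod H G) (u, b)) \<Longrightarrow> F k = \<psi>' (inv_into (carrier M) \<psi> k)"
    using gamma_iso.gamma_iso_extends[OF g] by (auto simp del: lex_prod_sel)
  have "F (\<psi> x) = \<psi>' x" if "x \<in> carrier M" for x
    using F(2)[OF pmv_isoD(2)[OF iso(1) that]] pmv_isoD(1)[OF iso(1)] that
    by (simp add: bij_betw_def inv_into_f_f)
  moreover have "lex_iso H u G G' F"
    using H rep rep' F(1)
    by (simp add: lex_iso_def lex_iso_axioms_def lex_product_def lex_representation_def)
  ultimately show thesis using that by blast
qed

lemma lex_representation_unique_of_hopfian:
  assumes H: "linear_abelian_unital_lgroup H u" and M: "pseudo_mv_algebra M"
    and rep: "lex_representation H u M G b \<psi>" and rep': "lex_representation H u M G' b' \<psi>'"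
    and "hopfian H u"
  shows "lgroup_isomorphic G G'"
proof -
  obtain F where F: "lex_iso H u G G' F" "\<And>x. x \<in> carrier M \<Longrightarrow> F (\<psi> x) = \<psi>' x"
    using lex_representations_extend[OF assms(1-4)] by blast
  \<comment> \<open>The unit of \<open>M\<close> ties \<open>b\<close> to \<open>b'\<close>: the
    extension \<open>F\<close> carries one strong unit to the other, and both have first coordinate
    \<open>u\<close>.\<close>
  have "\<psi> (pone M) = (u, b)" "\<psi>' (pone M) = (u, b')"
    using rep rep' by (auto simp: lex_representation_def Gamma_def dest: pmv_isoD(7))
  then have "F (u, b) = (u, b')"
    using F(2)[of "pone M"] pseudo_mv_algebra.closed(5)[OF M] by simp
  then show ?thesis
    using lex_iso.isomorphic_of_hopfian[OF F(1) assms(5)] rep by (simp add: lex_representation_def)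
qed

text \<open>Both representations single out the same subset of \<open>M\<close>, so \<open>F\<close>
  and its inverse preserve the bottom layer on the unit intervals, and then on the whole
  groups.\<close>

lemma lex_representation_unique_of_bottom:
  assumes H: "linear_abelian_unital_lgroup H u" and M: "pseudo_mv_algebra M"
    and rep: "lex_representation H u M G b \<psi>" and rep': "lex_representation H u M G' b' \<psi>'"
    and bottom: "respects_bottom H M \<psi> M0" "respects_bottom H M \<psi>' M0"
  shows "lgroup_isomorphic G G'"
proof -
  obtain F where ext: "lex_iso H u G G' F" "\<And>x. x \<in> carrier M \<Longrightarrow> F (\<psi> x) = \<psi>' x"
    using lex_representations_extend[OF assms(1-4)] by blast
  interpret lex_iso H u G G' F by (rule ext(1))
  let ?E = "inv_into (carrier (lex_prod H G)) F"
  interpret E: lex_iso H u G' G ?E by (rule inverse_lex_iso)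
  note inv = lgroup_iso_inv[OF D.group_lex F]
  have same: "fst (\<psi> x) = \<one>\<^bsub>H\<^esub> \<longleftrightarrow> fst (\<psi>' x) = \<one>\<^bsub>H\<^esub>" if "x \<in> carrier M" for x
    using bottom that unfolding respects_bottom_def by blast
  have surj: "\<psi> ` carrier M = carrier (Gamma (lex_prod H G) (u, b))"
    "\<psi>' ` carrier M = carrier (Gamma (lex_prod H G') (u, b'))"
    using pmv_isoD(1) rep rep' unfolding lex_representation_def bij_betw_def by blast+
  have "fst (F k) = \<one>\<^bsub>H\<^esub>" if "k \<in> carrier (Gamma (lex_prod H G) (u, b))" "fst k = \<one>\<^bsub>H\<^esub>" for k
    using that surj(1) ext(2) same by (metis imageE)
  then have 1: "fst (F k) = \<one>\<^bsub>H\<^esub>" if "k \<in> carrier (lex_prod H G)" "fst k = \<one>\<^bsub>H\<^esub>" for k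
    using kernel_of_bottom that by blast
  have "fst (?E k) = \<one>\<^bsub>H\<^esub>" if k: "k \<in> carrier (Gamma (lex_prod H G') (u, b'))" "fst k = \<one>\<^bsub>H\<^esub>" for k
  proof -
    obtain x where x: "x \<in> carrier M" "k = \<psi>' x" using k(1) unfolding surj(2)[symmetric] by blast
    have "\<psi> x \<in> carrier (Gamma (lex_prod H G) (u, b))"
      using x(1) unfolding surj(1)[symmetric] by blast
    then have "\<psi> x \<in> carrier (lex_prod H G)"
      by (simp only: D.L.Gamma_carrier)
    then have "?E k = \<psi> x" using inv(2)[of "\<psi> x"] ext(2)[OF x(1)] x(2) by simp
    then show ?thesis using same[OF x(1)] x(2) k(2) by simp
  qed
  then have "fst (?E k) = \<one>\<^bsub>H\<^esub>" if "k \<in> carrier (lex_prod H G')" "fst k = \<one>\<^bsub>H\<^esub>" for k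
    using E.kernel_of_bottom that by blast
  then show ?thesis
    using 1 inv(2) F_closed(1) by (intro isomorphic_of_kernel) metis
qed

section \<open>Existence of the lexicographic representation\<close>

context lex_product
begin

text \<open>The first coordinate alone decides: one more multiple of \<open>u\<close> than is
  required to bound \<open>h\<close> makes both bounds strict, so second coordinates are never
  compared.\<close>

lemma unital_lex:
  assumes b: "b \<in> carrier G" and u: "u \<noteq> \<one>\<^bsub>H\<^esub>"
  shows "unital_lgroup (lex_prod H G) (u, b)"
proof -
  have "\<exists>n::nat. inv\<^bsub>lex_prod H G\<^esub> ((u, b) [^]\<^bsub>lex_prod H G\<^esub> n) \<preceq>\<^bsub>lex_prod H G\<^esub> k \<and>
      k \<preceq>\<^bsub>lex_prod H G\<^esub> (u, b) [^]\<^bsub>lex_prod H G\<^esub> n"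
    if k: "k \<in> carrier (lex_prod H G)" for k
  proof -
    obtain h g where hg: "k = (h, g)" "h \<in> carrier H" "g \<in> carrier G" using k by auto
    obtain n :: nat where n: "inv\<^bsub>H\<^esub> (u [^]\<^bsub>H\<^esub> n) \<preceq>\<^bsub>H\<^esub> h" "h \<preceq>\<^bsub>H\<^esub> u [^]\<^bsub>H\<^esub> n"
      using H.unit_strong[OF hg(2)] by blast
    let ?p = "u [^]\<^bsub>H\<^esub> n" and ?q = "u [^]\<^bsub>H\<^esub> Suc n"
    have q: "?p \<in> carrier H" "?q \<in> carrier H" "?p \<preceq>\<^bsub>H\<^esub> ?q" "?p \<noteq> ?q"
      using u H.unit_closed H.unit_nonneg by auto
    have "h \<preceq>\<^bsub>H\<^esub> ?q"
      using H.lle_trans[OF n(2) q(3)] hg q by simp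
    moreover have "h \<noteq> ?q"
      using H.lle_antisym[OF q(3)] n(2) q by blast
    moreover have "inv\<^bsub>H\<^esub> ?q \<preceq>\<^bsub>H\<^esub> h"
      using H.lle_trans[OF _ n(1), of "inv\<^bsub>H\<^esub> ?q"] H.inv_le_inv_iff[OF q(2,1)] hg q by blast
    moreover have "inv\<^bsub>H\<^esub> ?q \<noteq> h"
    proof
      assume "inv\<^bsub>H\<^esub> ?q = h"
      then have "?q \<preceq>\<^bsub>H\<^esub> ?p" using n(1) H.inv_le_inv_iff[OF q(1,2)] by blast
      then show False using H.lle_antisym[OF q(3)] q by blast
    qed
    ultimately show ?thesis
      using hg q b H.unit_closed by (intro exI[of _ "Suc n"]) (simp add: pow_lex del: H.nat_pow_Suc)
  qed
  then show ?thesis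
    using b u H.unit_closed H.unit_nonneg L.lgroup_axioms
    by (auto simp: unital_lgroup_def unital_lgroup_axioms_def)
qed

lemma lex_meet_same:
  assumes "h \<in> carrier H" "g \<in> carrier G" "g' \<in> carrier G"
  shows "(h, g) \<sqinter>\<^bsub>lgroup_order (lex_prod H G)\<^esub> (h, g') = (h, g \<sqinter>\<^bsub>lgroup_order G\<^esub> g')"
  using assms G.meet_lle[of g g']
  by (intro L.meet_eqI) (auto intro: G.lle_meet dest: H.lle_antisym)

end

section \<open>Layers and central elements inside the group \<open>K\<close>\<close>

locale perfect_pmv = H: linear_abelian_unital_lgroup H u + K: unital_lgroup K w + pseudo_mv_algebra M
  for K :: "'k lgroup" (structure) and w and H :: "'h lgroup" (structure) and u
    and M :: "'a pmv" +
  fixes \<phi> :: "'a \<Rightarrow> 'k" and Mt :: "'h \<Rightarrow> 'a set" and c :: "'h \<Rightarrow> 'a"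
  assumes iso: "\<phi> \<in> pmv_iso M (Gamma K w)"
    and dec: "decomposition H u M Mt"
    and cen: "central_system H u M K \<phi> Mt c"
begin

abbreviation I where "I \<equiv> unit_interval H u"

text \<open>The components as seen in \<open>K\<close>, where differences are available that
  \<open>M\<close> expresses only through negations and truncated sums.\<close>

definition N where "N t = \<phi> ` Mt t"

definition d where "d t = \<phi> (c t)"

lemma units [simp]: "u \<in> carrier H" "\<one>\<^bsub>H\<^esub> \<preceq>\<^bsub>H\<^esub> u" "w \<in> carrier K" "\<one> \<preceq> w"
  using H.unit_closed H.unit_nonneg K.unit_closed K.unit_nonneg by auto

lemma I_iff: "t \<in> I \<longleftrightarrow> t \<in> carrier H \<and> \<one>\<^bsub>H\<^esub> \<preceq>\<^bsub>H\<^esub> t \<and> t \<preceq>\<^bsub>H\<^esub> u"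
  by (simp add: unit_interval_def)

lemma I_closed: "t \<in> I \<Longrightarrow> t \<in> carrier H"
  by (simp add: I_iff)

lemma I_ends [simp]: "\<one>\<^bsub>H\<^esub> \<in> I" "u \<in> I"
  by (simp_all add: I_iff)

lemma I_diff:
  assumes "s \<in> I" "t \<in> I" "t \<preceq>\<^bsub>H\<^esub> s"
  shows "s \<otimes>\<^bsub>H\<^esub> inv\<^bsub>H\<^esub> t \<in> I"
proof -
  have "u \<preceq>\<^bsub>H\<^esub> u \<otimes>\<^bsub>H\<^esub> t" using assms by (simp add: I_iff)
  then have "s \<preceq>\<^bsub>H\<^esub> u \<otimes>\<^bsub>H\<^esub> t"
    using assms by (auto simp: I_iff intro: H.lle_trans[of s u])
  then show ?thesis using assms by (simp add: I_iff H.inv_mult_le_iff)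
qed

lemma decD:
  shows "(\<Union>t \<in> I. Mt t) = carrier M"
    and "\<lbrakk>s \<in> I; t \<in> I; s \<noteq> t\<rbrakk> \<Longrightarrow> Mt s \<inter> Mt t = {}"
    and "\<lbrakk>s \<in> I; t \<in> I; s \<preceq>\<^bsub>H\<^esub> t; s \<noteq> t; x \<in> Mt s; y \<in> Mt t\<rbrakk> \<Longrightarrow> pmv_le M x y"
    and "t \<in> I \<Longrightarrow> lneg M ` Mt t = Mt (u \<otimes>\<^bsub>H\<^esub> inv\<^bsub>H\<^esub> t)"
    and "t \<in> I \<Longrightarrow> rneg M ` Mt t = Mt (u \<otimes>\<^bsub>H\<^esub> inv\<^bsub>H\<^esub> t)"
    and "\<lbrakk>s \<in> I; t \<in> I; x \<in> Mt s; y \<in> Mt t\<rbrakk>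
      \<Longrightarrow> x \<boxplus>\<^bsub>M\<^esub> y \<in> Mt ((s \<otimes>\<^bsub>H\<^esub> t) \<sqinter>\<^bsub>lgroup_order H\<^esub> u)"
  using dec unfolding decomposition_def by simp_all

lemma Mt_sub: "t \<in> I \<Longrightarrow> x \<in> Mt t \<Longrightarrow> x \<in> carrier M"
  using decD(1) by auto

lemma N_closed:
  assumes "t \<in> I" "k \<in> N t"
  shows "k \<in> carrier K" "\<one> \<preceq> k" "k \<preceq> w"
proof -
  obtain x where "x \<in> Mt t" "k = \<phi> x" using assms(2) by (auto simp: N_def)
  then have "k \<in> carrier (Gamma K w)"
    using pmv_isoD(2)[OF iso Mt_sub[OF assms(1)]] by blast
  then show "k \<in> carrier K" "\<one> \<preceq> k" "k \<preceq> w" by simp_all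
qed

lemma N_cover:
  assumes "k \<in> carrier K" "\<one> \<preceq> k" "k \<preceq> w"
  obtains t where "t \<in> I" "k \<in> N t"
proof -
  have "k \<in> \<phi> ` carrier M"
    using pmv_isoD(1)[OF iso] assms by (simp add: bij_betw_def)
  then obtain x where "x \<in> carrier M" "k = \<phi> x" by blast
  moreover from this obtain t where "t \<in> I" "x \<in> Mt t"
    using decD(1) by auto
  ultimately show thesis using that by (auto simp: N_def)
qed

lemma N_mem_iff: "\<lbrakk>t \<in> I; x \<in> carrier M\<rbrakk> \<Longrightarrow> \<phi> x \<in> N t \<longleftrightarrow> x \<in> Mt t"
  using pmv_isoD(8)[OF iso] Mt_sub by (auto simp: N_def)

lemma N_disjoint:
  assumes "s \<in> I" "t \<in> I" "k \<in> N s" "k \<in> N t"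
  shows "s = t"
proof (rule ccontr)
  assume "s \<noteq> t"
  then have "Mt s \<inter> Mt t = {}" using decD(2) assms(1,2) by blast
  moreover obtain x where "x \<in> Mt s" "k = \<phi> x" using assms(3) by (auto simp: N_def)
  ultimately show False using N_mem_iff[OF assms(2)] Mt_sub[OF assms(1)] assms(4) by blast
qed

text \<open>\<open>y\<close> is the truncated sum of \<open>x\<close> and a further element, and in
  the unit interval such a sum dominates \<open>x\<close>.\<close>

lemma le_of_pmv_le:
  assumes "x \<in> carrier M" "y \<in> carrier M" "pmv_le M x y"
  shows "\<phi> x \<preceq> \<phi> y"
proof -
  let ?z = "rneg M x \<boxdot>\<^bsub>M\<^esub> y"
  have z: "?z \<in> carrier M" using assms closed by (simp add: pprod_def)
  have "\<phi> y = \<phi> x \<boxplus>\<^bsub>Gamma K w\<^esub> \<phi> ?z"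
    using pmv_isoD(3)[OF iso assms(1) z] assms(3) by (simp add: pmv_le_def pjoin_def)
  moreover have "\<phi> x \<in> carrier (Gamma K w)" "\<phi> ?z \<in> carrier (Gamma K w)"
    using pmv_isoD(2)[OF iso] z assms(1) by blast+
  ultimately show ?thesis
    using K.lle_meet[of "\<phi> x" "\<phi> x \<otimes> \<phi> ?z" w] by (auto simp: Gamma_def)
qed

lemma N_order:
  assumes "s \<in> I" "t \<in> I" "s \<preceq>\<^bsub>H\<^esub> t" "s \<noteq> t" "x \<in> N s" "y \<in> N t"
  shows "x \<preceq> y"
proof -
  obtain x' y' where "x' \<in> Mt s" "x = \<phi> x'" "y' \<in> Mt t" "y = \<phi> y'"
    using assms by (auto simp: N_def)
  moreover from this have "pmv_le M x' y'"
    using decD(3) assms(1-4) by blast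
  ultimately show ?thesis using le_of_pmv_le Mt_sub assms(1,2) by blast
qed

lemma N_neg:
  assumes "t \<in> I" "k \<in> N t"
  shows "w \<otimes> inv k \<in> N (u \<otimes>\<^bsub>H\<^esub> inv\<^bsub>H\<^esub> t)" "inv k \<otimes> w \<in> N (u \<otimes>\<^bsub>H\<^esub> inv\<^bsub>H\<^esub> t)"
proof -
  obtain x where x: "x \<in> Mt t" "k = \<phi> x" using assms(2) by (auto simp: N_def)
  have "\<phi> (lneg M x) \<in> N (u \<otimes>\<^bsub>H\<^esub> inv\<^bsub>H\<^esub> t)" "\<phi> (rneg M x) \<in> N (u \<otimes>\<^bsub>H\<^esub> inv\<^bsub>H\<^esub> t)"
    using x(1) decD(4,5)[OF assms(1)] unfolding N_def by (metis imageI)+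
  then show "w \<otimes> inv k \<in> N (u \<otimes>\<^bsub>H\<^esub> inv\<^bsub>H\<^esub> t)" "inv k \<otimes> w \<in> N (u \<otimes>\<^bsub>H\<^esub> inv\<^bsub>H\<^esub> t)"
    using pmv_isoD(4,5)[OF iso Mt_sub[OF assms(1) x(1)]] x(2) by (simp_all add: Gamma_def)
qed

lemma N_add:
  assumes "s \<in> I" "t \<in> I" "x \<in> N s" "y \<in> N t"
  shows "(x \<otimes> y) \<sqinter>\<^bsub>lgroup_order K\<^esub> w \<in> N ((s \<otimes>\<^bsub>H\<^esub> t) \<sqinter>\<^bsub>lgroup_order H\<^esub> u)"
proof -
  obtain x' y' where xy: "x' \<in> Mt s" "x = \<phi> x'" "y' \<in> Mt t" "y = \<phi> y'"
    using assms by (auto simp: N_def)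
  then have "x' \<boxplus>\<^bsub>M\<^esub> y' \<in> Mt ((s \<otimes>\<^bsub>H\<^esub> t) \<sqinter>\<^bsub>lgroup_order H\<^esub> u)"
    using decD(6) assms(1,2) by blast
  then have "\<phi> (x' \<boxplus>\<^bsub>M\<^esub> y') \<in> N ((s \<otimes>\<^bsub>H\<^esub> t) \<sqinter>\<^bsub>lgroup_order H\<^esub> u)"
    unfolding N_def by blast
  then show ?thesis
    using pmv_isoD(3)[OF iso] Mt_sub assms xy by (simp add: Gamma_def)
qed

lemma N_mult:
  assumes "s \<in> I" "t \<in> I" "x \<in> N s" "y \<in> N t" "s \<otimes>\<^bsub>H\<^esub> t \<preceq>\<^bsub>H\<^esub> u" "x \<otimes> y \<preceq> w"
  shows "x \<otimes> y \<in> N (s \<otimes>\<^bsub>H\<^esub> t)"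
  using N_add[OF assms(1-4)] K.meet_absorb(1)[OF _ _ assms(6)] H.meet_absorb(1)[OF _ _ assms(5)]
    N_closed[OF assms(1,3)] N_closed[OF assms(2,4)] assms(1,2) by (simp add: I_iff)

text \<open>\<open>k\<close> lies in some layer. If that is not layer \<open>t\<close>, the order of
  the layers makes \<open>k\<close> equal to one of the two bounds.\<close>

lemma N_convex:
  assumes "t \<in> I" "x \<in> N t" "y \<in> N t" "k \<in> carrier K" "x \<preceq> k" "k \<preceq> y"
  shows "k \<in> N t"
proof -
  note x = N_closed[OF assms(1,2)] and y = N_closed[OF assms(1,3)]
  have "\<one> \<preceq> k" "k \<preceq> w"
    using K.lle_trans[OF x(2) assms(5)] K.lle_trans[OF assms(6) y(3)] x y assms by auto
  then obtain s where s: "s \<in> I" "k \<in> N s" using N_cover assms(4) by blast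
  consider "s = t" | "s \<noteq> t" "s \<preceq>\<^bsub>H\<^esub> t" | "s \<noteq> t" "t \<preceq>\<^bsub>H\<^esub> s"
    using H.lle_total[of s t] s assms(1) by (auto simp: I_iff)
  then show ?thesis
  proof cases
    case 2
    then have "k \<preceq> x" using N_order s assms by blast
    then show ?thesis using K.lle_antisym assms x by blast
  next
    case 3
    then have "y \<preceq> k" using N_order[of t s y k] s assms by blast
    then show ?thesis using K.lle_antisym[of k y] assms y by blast
  qed (use s in simp)
qed

text \<open>In an \<open>\<ell>\<close>-group the right negation of \<open>x\<^sup>- \<oplus> y\<close> is the positive part of \<open>-y + x\<close>.\<close>

lemma N_positive_part:
  assumes st: "s \<in> I" "t \<in> I" "t \<preceq>\<^bsub>H\<^esub> s" and x: "x \<in> N s" and y: "y \<in> N t"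
  shows "inv ((w \<otimes> inv x \<otimes> y) \<sqinter>\<^bsub>lgroup_order K\<^esub> w) \<otimes> w \<in> N (s \<otimes>\<^bsub>H\<^esub> inv\<^bsub>H\<^esub> t)"
proof -
  note cl = I_closed[OF st(1)] I_closed[OF st(2)]
  let ?r = "u \<otimes>\<^bsub>H\<^esub> inv\<^bsub>H\<^esub> s \<otimes>\<^bsub>H\<^esub> t"
  have us: "u \<otimes>\<^bsub>H\<^esub> inv\<^bsub>H\<^esub> s \<in> I"
    using I_diff[OF I_ends(2) st(1)] st by (simp add: I_iff)
  have r: "?r \<preceq>\<^bsub>H\<^esub> u"
    using cl st(3) H.inv_mult_le_iff(1)[of s t "\<one>\<^bsub>H\<^esub>"] by (simp add: H.m_assoc)
  have r_eq: "?r = u \<otimes>\<^bsub>H\<^esub> inv\<^bsub>H\<^esub> (s \<otimes>\<^bsub>H\<^esub> inv\<^bsub>H\<^esub> t)"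
    using cl by (simp add: H.inv_mult_group H.m_ac)
  have neg_neg: "u \<otimes>\<^bsub>H\<^esub> inv\<^bsub>H\<^esub> (u \<otimes>\<^bsub>H\<^esub> inv\<^bsub>H\<^esub> a) = a" if "a \<in> carrier H" for a
    using that H.m_comm[of a "inv\<^bsub>H\<^esub> u"] by (simp add: H.inv_mult_group)
  have m: "(w \<otimes> inv x \<otimes> y) \<sqinter>\<^bsub>lgroup_order K\<^esub> w \<in> N ?r"
    using N_add[OF us st(2) N_neg(1)[OF st(1) x] y] H.meet_absorb(1)[OF _ _ r] cl by simp
  have "?r \<in> I"
    using I_diff[OF I_ends(2) I_diff[OF st]] I_diff[OF st] unfolding r_eq by (simp add: I_iff)
  moreover have "u \<otimes>\<^bsub>H\<^esub> inv\<^bsub>H\<^esub> ?r = s \<otimes>\<^bsub>H\<^esub> inv\<^bsub>H\<^esub> t"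
    unfolding r_eq using cl neg_neg by simp
  ultimately show ?thesis
    using N_neg(2)[OF _ m] by simp
qed

text \<open>For \<open>y \<preceq> x\<close> the truncation is inactive and the positive part of
  \<open>-y + x\<close> is this element itself.\<close>

lemma N_diff:
  assumes st: "s \<in> I" "t \<in> I" "t \<preceq>\<^bsub>H\<^esub> s" and x: "x \<in> N s" and y: "y \<in> N t" and le: "y \<preceq> x"
  shows "inv y \<otimes> x \<in> N (s \<otimes>\<^bsub>H\<^esub> inv\<^bsub>H\<^esub> t)"
proof -
  note cl = N_closed[OF st(1) x] N_closed[OF st(2) y]
  have "w \<otimes> inv x \<otimes> y \<preceq> w"
    using cl le K.inv_mult_le_iff(1)[of x y \<one>] by (simp add: K.m_assoc)
  then have "(w \<otimes> inv x \<otimes> y) \<sqinter>\<^bsub>lgroup_order K\<^esub> w = w \<otimes> inv x \<otimes> y"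
    using K.meet_absorb(1) cl by simp
  then show ?thesis
    using N_positive_part[OF st x y] cl by (simp add: K.inv_mult_group K.m_assoc)
qed

lemma d_mem: "t \<in> I \<Longrightarrow> d t \<in> N t"
  using cen by (auto simp: central_system_def N_def d_def)

lemma d_closed: "t \<in> I \<Longrightarrow> d t \<in> carrier K"
  using N_closed(1) d_mem by blast

lemma d_comm: "\<lbrakk>t \<in> I; k \<in> carrier K\<rbrakk> \<Longrightarrow> k \<otimes> d t = d t \<otimes> k"
  using cen by (auto simp: central_system_def center_def d_def)

lemma d_one: "d \<one>\<^bsub>H\<^esub> = \<one>"
  using cen pmv_isoD(6)[OF iso] by (simp add: central_system_def d_def Gamma_def)

lemma one_mem: "\<one> \<in> N \<one>\<^bsub>H\<^esub>"
  using d_mem[of "\<one>\<^bsub>H\<^esub>"] d_one by simp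

lemma w_mem: "w \<in> N u"
  using N_neg(1)[OF _ one_mem] by simp

text \<open>A defined partial sum has product zero. Unravelled in \<open>Gamma\<close>, and using
  centrality of \<open>d t\<close>, this says that \<open>d s \<otimes> d t\<close> does not exceed
  \<open>w\<close>, so the sum is not truncated.\<close>

lemma d_mult:
  assumes st: "s \<in> I" "t \<in> I" "s \<otimes>\<^bsub>H\<^esub> t \<preceq>\<^bsub>H\<^esub> u"
  shows "d (s \<otimes>\<^bsub>H\<^esub> t) = d s \<otimes> d t"
proof -
  note cl = N_closed[OF st(1) d_mem[OF st(1)]] N_closed[OF st(2) d_mem[OF st(2)]]
  have cM: "c s \<in> carrier M" "c t \<in> carrier M"
    using cen Mt_sub st unfolding central_system_def by blast+
  have "partial_sum M (c s) (c t) (c (s \<otimes>\<^bsub>H\<^esub> t))"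
    using cen st unfolding central_system_def by blast
  then have 1: "rneg M (lneg M (c t) \<boxplus>\<^bsub>M\<^esub> lneg M (c s)) = pzero M" "c (s \<otimes>\<^bsub>H\<^esub> t) = c s \<boxplus>\<^bsub>M\<^esub> c t"
    by (simp_all add: partial_sum_def pprod_def)
  have "rneg (Gamma K w) (lneg (Gamma K w) (d t) \<boxplus>\<^bsub>Gamma K w\<^esub> lneg (Gamma K w) (d s)) = \<one>"
    using arg_cong[OF 1(1), of \<phi>] closed cM pmv_isoD(3-6)[OF iso] by (simp add: d_def Gamma_def)
  moreover have n: "lneg (Gamma K w) (d t) = w \<otimes> inv d t" "lneg (Gamma K w) (d s) = w \<otimes> inv d s"
    "\<And>k. rneg (Gamma K w) k = inv k \<otimes> w"
    by (simp_all add: Gamma_def)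
  moreover have mcl: "(w \<otimes> inv d t) \<boxplus>\<^bsub>Gamma K w\<^esub> (w \<otimes> inv d s) \<in> carrier K"
    using cl K.meet_lle(3) by (simp add: Gamma_def)
  ultimately have "(w \<otimes> inv d t) \<boxplus>\<^bsub>Gamma K w\<^esub> (w \<otimes> inv d s) = w"
    using K.mult_inv_cancel(1)[OF mcl, of w] by simp
  then have "w \<preceq> (w \<otimes> inv d t) \<otimes> (w \<otimes> inv d s)"
    using K.Gamma_padd_eq_unit_iff[of w "w \<otimes> inv d t" "w \<otimes> inv d s"] cl by simp
  then have "d s \<otimes> d t \<preceq> w"
    using cl K.mult_left_le_iff[of \<one> "inv d t \<otimes> (w \<otimes> inv d s)" w]
    by (simp add: K.m_assoc K.inv_mult_le_iff d_comm[OF st(2)])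
  then show ?thesis
    using K.Gamma_padd_eq_mult[of w "d s" "d t"] cl 1(2) pmv_isoD(3)[OF iso cM]
    by (simp add: d_def)
qed

end

section \<open>The group of infinitesimals\<close>

context perfect_pmv
begin

text \<open>For nonzero \<open>u\<close> this is the convex subgroup generated by the bottom layer;
  single bounds take the place of finite sums, because the layer is closed under addition.\<close>

definition infinitesimals :: "'k lgroup" where
  "infinitesimals =
    \<lparr>carrier = {g \<in> carrier K. \<exists>x \<in> N \<one>\<^bsub>H\<^esub>. \<exists>y \<in> N \<one>\<^bsub>H\<^esub>. inv x \<preceq> g \<and> g \<preceq> y},
     mult = mult K, one = one K, lle = lle K\<rparr>"

lemma infinitesimals_sel [simp]:
  "g \<in> carrier infinitesimals \<longleftrightarrow>
    g \<in> carrier K \<and> (\<exists>x \<in> N \<one>\<^bsub>H\<^esub>. \<exists>y \<in> N \<one>\<^bsub>H\<^esub>. inv x \<preceq> g \<and> g \<preceq> y)"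
  "g \<otimes>\<^bsub>infinitesimals\<^esub> h = g \<otimes> h" "\<one>\<^bsub>infinitesimals\<^esub> = \<one>"
  "g \<preceq>\<^bsub>infinitesimals\<^esub> h \<longleftrightarrow> g \<preceq> h"
  by (simp_all add: infinitesimals_def)

end

locale perfect_pmv_nontrivial = perfect_pmv +
  assumes unit_nontrivial: "u \<noteq> \<one>\<^bsub>H\<^esub>"
begin

text \<open>As zero and \<open>u\<close> are different indices, the bottom layer lies below the top
  layer. Thus \<open>x\<close> is below the negation of \<open>y\<close>, and the sum stays in the
  unit interval.\<close>

lemma N0_mult:
  assumes "x \<in> N \<one>\<^bsub>H\<^esub>" "y \<in> N \<one>\<^bsub>H\<^esub>"
  shows "x \<otimes> y \<in> N \<one>\<^bsub>H\<^esub>"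
proof -
  note cl = N_closed[OF I_ends(1) assms(1)] N_closed[OF I_ends(1) assms(2)]
  have "x \<preceq> w \<otimes> inv y"
    using N_order[of "\<one>\<^bsub>H\<^esub>" u x "w \<otimes> inv y"] N_neg(1)[OF I_ends(1) assms(2)] unit_nontrivial assms(1)
    by simp
  then have "x \<otimes> y \<preceq> w" using cl by (simp add: K.inv_mult_le_iff)
  then show ?thesis using N_mult[of "\<one>\<^bsub>H\<^esub>" "\<one>\<^bsub>H\<^esub>" x y] assms by simp
qed

lemma infinitesimalE:
  assumes "g \<in> carrier infinitesimals"
  obtains x y where "x \<in> N \<one>\<^bsub>H\<^esub>" "y \<in> N \<one>\<^bsub>H\<^esub>" "x \<in> carrier K" "y \<in> carrier K" "g \<in> carrier K"
    "inv x \<preceq> g" "g \<preceq> y"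
  using assms N_closed(1)[OF I_ends(1)] by auto

lemma infinitesimalI:
  "\<lbrakk>g \<in> carrier K; x \<in> N \<one>\<^bsub>H\<^esub>; y \<in> N \<one>\<^bsub>H\<^esub>; inv x \<preceq> g; g \<preceq> y\<rbrakk>
    \<Longrightarrow> g \<in> carrier infinitesimals"
  by auto

lemma group_infinitesimals: "group infinitesimals"
proof (rule groupI)
  fix g h assume g: "g \<in> carrier infinitesimals" and h: "h \<in> carrier infinitesimals"
  obtain x y where xy: "x \<in> N \<one>\<^bsub>H\<^esub>" "y \<in> N \<one>\<^bsub>H\<^esub>" "x \<in> carrier K" "y \<in> carrier K" "g \<in> carrier K"
    "inv x \<preceq> g" "g \<preceq> y" using infinitesimalE[OF g] .
  obtain x' y' where xy': "x' \<in> N \<one>\<^bsub>H\<^esub>" "y' \<in> N \<one>\<^bsub>H\<^esub>" "x' \<in> carrier K" "y' \<in> carrier K" "h \<in> carrier K"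
    "inv x' \<preceq> h" "h \<preceq> y'" using infinitesimalE[OF h] .
  show "g \<otimes>\<^bsub>infinitesimals\<^esub> h \<in> carrier infinitesimals"
    using K.mult_le_mono[OF xy(6) xy'(6)] K.mult_le_mono[OF xy(7) xy'(7)] xy xy' N0_mult
    by (intro infinitesimalI[of _ "x' \<otimes> x" "y \<otimes> y'"]) (auto simp: K.inv_mult_group)
next
  show "\<one>\<^bsub>infinitesimals\<^esub> \<in> carrier infinitesimals"
    using one_mem by (intro infinitesimalI[of _ \<one> \<one>]) auto
next
  fix g assume g: "g \<in> carrier infinitesimals"
  obtain x y where xy: "x \<in> N \<one>\<^bsub>H\<^esub>" "y \<in> N \<one>\<^bsub>H\<^esub>" "x \<in> carrier K" "y \<in> carrier K" "g \<in> carrier K"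
    "inv x \<preceq> g" "g \<preceq> y" using infinitesimalE[OF g] .
  then have "inv g \<in> carrier infinitesimals"
    using K.inv_le_inv_iff[of g "inv x"] by (intro infinitesimalI[of _ y x]) auto
  then show "\<exists>h \<in> carrier infinitesimals. h \<otimes>\<^bsub>infinitesimals\<^esub> g = \<one>\<^bsub>infinitesimals\<^esub>"
    using xy(5) by (intro bexI[of _ "inv g"]) simp_all
qed (auto simp: K.m_assoc)

sublocale Inf: lgroup infinitesimals
proof (rule lgroupI[OF group_infinitesimals])
  fix g h assume g: "g \<in> carrier infinitesimals" and h: "h \<in> carrier infinitesimals"
  obtain x y where xy: "x \<in> N \<one>\<^bsub>H\<^esub>" "y \<in> N \<one>\<^bsub>H\<^esub>" "x \<in> carrier K" "y \<in> carrier K" "g \<in> carrier K"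
    "inv x \<preceq> g" "g \<preceq> y" using infinitesimalE[OF g] .
  obtain x' y' where xy': "x' \<in> N \<one>\<^bsub>H\<^esub>" "y' \<in> N \<one>\<^bsub>H\<^esub>" "x' \<in> carrier K" "y' \<in> carrier K" "h \<in> carrier K"
    "inv x' \<preceq> h" "h \<preceq> y'" using infinitesimalE[OF h] .
  obtain s where s: "s \<in> carrier K" "g \<preceq> s" "h \<preceq> s"
    "\<And>z. \<lbrakk>z \<in> carrier K; g \<preceq> z; h \<preceq> z\<rbrakk> \<Longrightarrow> s \<preceq> z"
    using K.obtain_sup[OF xy(5) xy'(5)] by metis
  have yy: "\<one> \<preceq> y" "\<one> \<preceq> y'" using N_closed(2)[OF I_ends(1)] xy(2) xy'(2) by auto
  then have "y \<preceq> y \<otimes> y'" "y' \<preceq> y \<otimes> y'" using xy(4) xy'(4) by simp_all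
  \<comment> \<open>The upper bounds of \<open>g\<close> and \<open>h\<close> add up to a common
    one, so the join taken in \<open>K\<close> stays inside the subgroup.\<close>
  then have "g \<preceq> y \<otimes> y'" "h \<preceq> y \<otimes> y'"
    using K.lle_trans[OF xy(7)] K.lle_trans[OF xy'(7)] xy xy' by simp_all
  then have "s \<preceq> y \<otimes> y'" using s(4) xy(4) xy'(4) by simp
  moreover have "inv x \<preceq> s" using K.lle_trans[OF xy(6) s(2)] xy s(1) by simp
  ultimately have "s \<in> carrier infinitesimals"
    using s(1) xy(1) N0_mult[OF xy(2) xy'(2)] by (intro infinitesimalI)
  then show "\<exists>s \<in> carrier infinitesimals. g \<preceq>\<^bsub>infinitesimals\<^esub> s \<and> h \<preceq>\<^bsub>infinitesimals\<^esub> s \<and>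
      (\<forall>z \<in> carrier infinitesimals. g \<preceq>\<^bsub>infinitesimals\<^esub> z \<and> h \<preceq>\<^bsub>infinitesimals\<^esub> z
        \<longrightarrow> s \<preceq>\<^bsub>infinitesimals\<^esub> z)"
    using s by (intro bexI[of _ s]) simp_all
qed (auto intro: K.lle_antisym K.lle_trans)

sublocale lex_product H u infinitesimals ..

lemma Inf_inv [simp]: "g \<in> carrier infinitesimals \<Longrightarrow> inv\<^bsub>infinitesimals\<^esub> g = inv g"
  using Inf.r_inv[of g] Inf.inv_closed[of g] K.inv_equality[of "inv\<^bsub>infinitesimals\<^esub> g" g] Inf.l_inv[of g]
  by (simp add: infinitesimals_sel)

text \<open>By \<open>N_positive_part\<close> with equal indices, the positive part of
  \<open>-y + x\<close> lies in the bottom layer and bounds \<open>-y + x\<close> from above;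
  exchanging \<open>x\<close> and \<open>y\<close> gives the bound from below.\<close>

lemma quotient_infinitesimal:
  assumes t: "t \<in> I" and x: "x \<in> N t" and y: "y \<in> N t"
  shows "inv y \<otimes> x \<in> carrier infinitesimals"
proof -
  have *: "\<exists>p \<in> N \<one>\<^bsub>H\<^esub>. inv y \<otimes> x \<preceq> p" if x: "x \<in> N t" and y: "y \<in> N t" for x y
  proof -
    note cl = N_closed[OF t x] N_closed[OF t y]
    let ?m = "(w \<otimes> inv x \<otimes> y) \<sqinter>\<^bsub>lgroup_order K\<^esub> w"
    have m: "?m \<in> carrier K" "?m \<preceq> w \<otimes> inv x \<otimes> y"
      using K.meet_lle[of "w \<otimes> inv x \<otimes> y" w] cl by auto
    then have "inv (w \<otimes> inv x \<otimes> y) \<otimes> w \<preceq> inv ?m \<otimes> w"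
      using cl by simp
    then have "inv y \<otimes> x \<preceq> inv ?m \<otimes> w"
      using cl by (simp add: K.inv_mult_group K.m_assoc)
    moreover have "inv ?m \<otimes> w \<in> N \<one>\<^bsub>H\<^esub>"
      using N_positive_part[OF t t _ x y] I_closed[OF t] by simp
    ultimately show ?thesis by blast
  qed
  note cl = N_closed[OF t x] N_closed[OF t y]
  obtain p q where pq: "p \<in> N \<one>\<^bsub>H\<^esub>" "inv y \<otimes> x \<preceq> p" "q \<in> N \<one>\<^bsub>H\<^esub>" "inv x \<otimes> y \<preceq> q"
    using *[OF x y] *[OF y x] by blast
  then have "inv q \<preceq> inv (inv x \<otimes> y)"
    using K.inv_le_inv_iff N_closed(1)[OF I_ends(1)] cl by simp
  then show ?thesis
    using pq cl by (intro infinitesimalI[of _ q p]) (simp_all add: K.inv_mult_group)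
qed

section \<open>Splitting an element into layer index and infinitesimal part\<close>

definition b where "b = inv d u \<otimes> w"

lemma b_closed: "b \<in> carrier infinitesimals"
  unfolding b_def using quotient_infinitesimal[OF I_ends(2) w_mem d_mem] by simp

lemma w_eq: "w = d u \<otimes> b"
  using d_closed[of u] by (simp add: b_def)

definition level where "level k = (THE t. t \<in> I \<and> k \<in> N t)"

lemma level_eq: "\<lbrakk>t \<in> I; k \<in> N t\<rbrakk> \<Longrightarrow> level k = t"
  unfolding level_def using N_disjoint by (intro the_equality) auto

definition split where "split k = (level k, inv d (level k) \<otimes> k)"

lemma split_eq: "\<lbrakk>t \<in> I; k \<in> N t\<rbrakk> \<Longrightarrow> split k = (t, inv d t \<otimes> k)"
  by (simp add: split_def level_eq)

abbreviation lex_interval where "lex_interval \<equiv> Gamma (lex_prod H infinitesimals) (u, b)"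

lemma lex_interval_iff:
  "(t, g) \<in> carrier lex_interval \<longleftrightarrow>
    t \<in> I \<and> g \<in> carrier infinitesimals \<and> (t = \<one>\<^bsub>H\<^esub> \<longrightarrow> \<one> \<preceq> g) \<and> (t = u \<longrightarrow> g \<preceq> b)"
  using b_closed unit_nontrivial by (auto simp: I_iff simp del: infinitesimals_sel(1))

lemma split_closed:
  assumes t: "t \<in> I" and k: "k \<in> N t"
  shows "split k \<in> carrier lex_interval"
proof -
  note cl = N_closed[OF t k]
  have "inv d t \<otimes> k \<in> carrier infinitesimals"
    using quotient_infinitesimal[OF t k d_mem[OF t]] .
  moreover have "t = \<one>\<^bsub>H\<^esub> \<Longrightarrow> \<one> \<preceq> inv d t \<otimes> k" using cl by (simp add: d_one)
  moreover have "t = u \<Longrightarrow> inv d t \<otimes> k \<preceq> b" using cl d_closed[of u] by (simp add: b_def)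
  ultimately show ?thesis
    unfolding split_eq[OF t k] lex_interval_iff using t by blast
qed

text \<open>\<open>d t \<otimes> g\<close> is enclosed between two elements of layer
  \<open>t\<close>, and convexity applies. With \<open>-x\<close> and \<open>y\<close> bounding
  \<open>g\<close>, these are \<open>d t - x\<close> and \<open>d t + y\<close>, which stay in the
  interval by the order of the layers. In the bottom layer zero replaces the lower one and in the
  top layer \<open>w\<close> the upper one, by the extra condition on \<open>g\<close>.\<close>

lemma shift_mem:
  assumes tg: "(t, g) \<in> carrier lex_interval"
  shows "t \<in> I" "d t \<otimes> g \<in> N t"
proof -
  have t: "t \<in> I" and g: "g \<in> carrier infinitesimals"
    and lo: "t = \<one>\<^bsub>H\<^esub> \<Longrightarrow> \<one> \<preceq> g" and hi: "t = u \<Longrightarrow> g \<preceq> b"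
    using tg unfolding lex_interval_iff by blast+
  obtain x y where xy: "x \<in> N \<one>\<^bsub>H\<^esub>" "y \<in> N \<one>\<^bsub>H\<^esub>" "x \<in> carrier K" "y \<in> carrier K" "g \<in> carrier K"
    "inv x \<preceq> g" "g \<preceq> y" using infinitesimalE[OF g] .
  note dt = d_closed[OF t]
  have "\<exists>p \<in> N t. p \<preceq> d t \<otimes> g"
  proof (cases "t = \<one>\<^bsub>H\<^esub>")
    case True
    then show ?thesis using lo d_one one_mem xy(5) by (intro bexI[of _ \<one>]) auto
  next
    case False
    then have "x \<preceq> d t"
      using N_order[OF I_ends(1) t _ _ xy(1) d_mem[OF t]] t by (auto simp: I_iff)
    then have "inv x \<otimes> d t \<in> N t"
      using N_diff[OF t I_ends(1) _ d_mem[OF t] xy(1)] t by (simp add: I_iff)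
    moreover have "inv x \<otimes> d t \<preceq> d t \<otimes> g"
      using xy dt d_comm[OF t, of "inv x"] by simp
    ultimately show ?thesis by blast
  qed
  moreover have "\<exists>q \<in> N t. d t \<otimes> g \<preceq> q"
  proof (cases "t = u")
    case True
    then show ?thesis
      using w_mem w_eq hi xy(5) dt b_closed by (intro bexI[of _ w]) (auto simp: b_def K.inv_mult_le_iff)
  next
    case False
    have "d t \<preceq> w \<otimes> inv y"
      using N_order[OF t I_ends(2) _ False d_mem[OF t], of "w \<otimes> inv y"]
        N_neg(1)[OF I_ends(1) xy(2)] t by (simp add: I_iff)
    then have "d t \<otimes> y \<preceq> w"
      using dt xy by (simp add: K.inv_mult_le_iff)
    then have "d t \<otimes> y \<in> N t"
      using N_mult[OF t I_ends(1) d_mem[OF t] xy(2)] t by (simp add: I_iff)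
    moreover have "d t \<otimes> g \<preceq> d t \<otimes> y" using xy dt by simp
    ultimately show ?thesis by blast
  qed
  ultimately obtain p q where "p \<in> N t" "q \<in> N t" "p \<preceq> d t \<otimes> g" "d t \<otimes> g \<preceq> q"
    by blast
  then show "d t \<otimes> g \<in> N t"
    using N_convex[OF t, of p q "d t \<otimes> g"] dt xy(5) by simp
  show "t \<in> I" by (rule t)
qed

lemma split_bij: "bij_betw split (carrier (Gamma K w)) (carrier lex_interval)"
proof (rule bij_betw_byWitness[where f' = "\<lambda>(t, g). d t \<otimes> g"])
  show "\<forall>k \<in> carrier (Gamma K w). (case split k of (t, g) \<Rightarrow> d t \<otimes> g) = k"
  proof
    fix k assume "k \<in> carrier (Gamma K w)"
    then obtain t where t: "t \<in> I" "k \<in> N t" using N_cover by auto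
    then show "(case split k of (t, g) \<Rightarrow> d t \<otimes> g) = k"
      using N_closed(1)[OF t] d_closed[OF t(1)] by (simp add: split_eq[OF t])
  qed
  show "\<forall>p \<in> carrier lex_interval. split (case p of (t, g) \<Rightarrow> d t \<otimes> g) = p"
  proof
    fix p assume p: "p \<in> carrier lex_interval"
    obtain t g where tg: "p = (t, g)" by (cases p)
    have g: "g \<in> carrier K" using p unfolding tg lex_interval_iff by simp
    show "split (case p of (t, g) \<Rightarrow> d t \<otimes> g) = p"
      using split_eq[OF shift_mem[OF p[unfolded tg]]] d_closed[OF shift_mem(1)[OF p[unfolded tg]]] g
      by (simp add: tg)
  qed
  show "split ` carrier (Gamma K w) \<subseteq> carrier lex_interval"
  proof
    fix p assume "p \<in> split ` carrier (Gamma K w)"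
    then obtain k where k: "k \<in> carrier (Gamma K w)" "p = split k" by blast
    then obtain t where "t \<in> I" "k \<in> N t" using N_cover by auto
    then show "p \<in> carrier lex_interval" using split_closed k(2) by blast
  qed
  show "(\<lambda>(t, g). d t \<otimes> g) ` carrier lex_interval \<subseteq> carrier (Gamma K w)"
  proof
    fix k assume "k \<in> (\<lambda>(t, g). d t \<otimes> g) ` carrier lex_interval"
    then obtain t g where tg: "(t, g) \<in> carrier lex_interval" and k: "k = d t \<otimes> g" by auto
    show "k \<in> carrier (Gamma K w)"
      unfolding K.Gamma_carrier k using N_closed[OF shift_mem[OF tg]] by blast
  qed
qed

lemma d_complement:
  assumes "t \<in> I"
  shows "d u = d (u \<otimes>\<^bsub>H\<^esub> inv\<^bsub>H\<^esub> t) \<otimes> d t"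
  using d_mult[OF I_diff[OF I_ends(2) assms] assms] assms by (simp add: I_iff H.m_assoc)

text \<open>Everything reduces to \<open>d t + b = -d (u - t) + w\<close>, which holds because
  \<open>d (u - t)\<close> and \<open>d t\<close> add up to \<open>d u\<close> and
  \<open>b = -d u + w\<close>. Centrality then serves both negations, which differ in the order of
  the terms.\<close>

lemma split_neg:
  assumes t: "t \<in> I" and k: "k \<in> N t"
  shows "split (w \<otimes> inv k) = lneg lex_interval (split k)"
    "split (inv k \<otimes> w) = rneg lex_interval (split k)"
proof -
  let ?t = "u \<otimes>\<^bsub>H\<^esub> inv\<^bsub>H\<^esub> t"
  have t': "?t \<in> I" using I_diff[OF I_ends(2) t] t by (simp add: I_iff)
  note cl = N_closed[OF t k] d_closed[OF t] d_closed[OF t'] I_closed[OF t]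
  have q: "inv d t \<otimes> k \<in> carrier infinitesimals"
    using quotient_infinitesimal[OF t k d_mem[OF t]] .
  have bK: "b \<in> carrier K" using b_closed by simp
  have bdt: "b \<otimes> inv k \<otimes> d t = inv d ?t \<otimes> (w \<otimes> inv k)"
    "inv k \<otimes> d t \<otimes> b = inv d ?t \<otimes> (inv k \<otimes> w)"
  proof -
    have bw: "d t \<otimes> b = inv d ?t \<otimes> w"
      unfolding b_def d_complement[OF t] using cl by (simp add: K.inv_mult_group K.m_assoc)
    have "b \<otimes> inv k \<otimes> d t = d t \<otimes> b \<otimes> inv k"
      using d_comm[OF t, of "b \<otimes> inv k"] cl bK by (simp add: K.m_assoc)
    then show "b \<otimes> inv k \<otimes> d t = inv d ?t \<otimes> (w \<otimes> inv k)"
      using bw cl by (simp add: K.m_assoc)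
    have "inv k \<otimes> inv d ?t = inv d ?t \<otimes> inv k"
      using d_comm[OF t', of k] cl by (simp flip: K.inv_mult_group)
    then have "inv k \<otimes> (inv d ?t \<otimes> w) = inv d ?t \<otimes> (inv k \<otimes> w)"
      using cl by (simp flip: K.m_assoc)
    then show "inv k \<otimes> d t \<otimes> b = inv d ?t \<otimes> (inv k \<otimes> w)"
      using bw cl bK by (simp add: K.m_assoc)
  qed
  show "split (w \<otimes> inv k) = lneg lex_interval (split k)"
    using q cl bK bdt(1) b_closed unfolding split_eq[OF t k] split_eq[OF t' N_neg(1)[OF t k]]
    by (simp add: Gamma_def K.inv_mult_group K.m_assoc del: infinitesimals_sel(1))
  show "split (inv k \<otimes> w) = rneg lex_interval (split k)"
    using q cl bK bdt(2) b_closed unfolding split_eq[OF t k] split_eq[OF t' N_neg(2)[OF t k]]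
    by (simp add: Gamma_def K.inv_mult_group K.m_assoc H.m_comm del: infinitesimals_sel(1))
qed

text \<open>If the indices add up to less than \<open>u\<close>, the order of the layers places
  \<open>x + y\<close> below \<open>w\<close>; if to more, above \<open>w\<close>. Accordingly both
  sides are untruncated or both are the unit. Only when the indices add up to exactly
  \<open>u\<close> must two meets be compared.\<close>

lemma split_padd:
  assumes s: "s \<in> I" and t: "t \<in> I" and x: "x \<in> N s" and y: "y \<in> N t"
  shows "split (x \<boxplus>\<^bsub>Gamma K w\<^esub> y) = split x \<boxplus>\<^bsub>lex_interval\<^esub> split y"
proof -
  let ?h = "s \<otimes>\<^bsub>H\<^esub> t" and ?g = "(inv d s \<otimes> x) \<otimes> (inv d t \<otimes> y)"
  let ?m = "(x \<otimes> y) \<sqinter>\<^bsub>lgroup_order K\<^esub> w"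
  note cl = N_closed[OF s x] N_closed[OF t y] d_closed[OF s] d_closed[OF t] I_closed[OF s] I_closed[OF t]
  have q: "inv d s \<otimes> x \<in> carrier infinitesimals" "inv d t \<otimes> y \<in> carrier infinitesimals"
    using quotient_infinitesimal s t x y d_mem by blast+
  then have g: "?g \<in> carrier infinitesimals"
    using Inf.m_closed by (metis infinitesimals_sel(2))
  \<comment> \<open>Since \<open>d t\<close> is central, the infinitesimal parts of \<open>x\<close>
    and \<open>y\<close> add up to \<open>x + y\<close> diminished by
    \<open>d s + d t\<close>.\<close>
  have g_eq: "?g = inv (d s \<otimes> d t) \<otimes> (x \<otimes> y)"
  proof -
    have "x \<otimes> inv d t = inv d t \<otimes> x"
      using cl d_comm[OF t, of "inv x"] K.inv_mult_group[of "inv x" "d t"] K.inv_mult_group[of "d t" "inv x"]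
      by simp
    then have "x \<otimes> (inv d t \<otimes> y) = inv d t \<otimes> (x \<otimes> y)"
      using cl by (simp flip: K.m_assoc)
    moreover have "inv (d s \<otimes> d t) = inv d s \<otimes> inv d t"
      using cl d_comm[OF t, of "d s"] by (simp add: K.inv_mult_group)
    ultimately show ?thesis using cl by (simp add: K.m_assoc)
  qed
  have rhs: "split x \<boxplus>\<^bsub>lex_interval\<^esub> split y
      = (?h, ?g) \<sqinter>\<^bsub>lgroup_order (lex_prod H infinitesimals)\<^esub> (u, b)"
    unfolding split_eq[OF s x] split_eq[OF t y] by (simp add: Gamma_def)
  have lhs: "x \<boxplus>\<^bsub>Gamma K w\<^esub> y = ?m" by (simp add: Gamma_def)
  have m: "?m \<in> N (?h \<sqinter>\<^bsub>lgroup_order H\<^esub> u)" using N_add[OF s t x y] .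
  have t': "u \<otimes>\<^bsub>H\<^esub> inv\<^bsub>H\<^esub> t \<in> I" using I_diff[OF I_ends(2) t] t by (simp add: I_iff)
  note ny = N_neg(1)[OF t y]
  consider "?h \<preceq>\<^bsub>H\<^esub> u" "?h \<noteq> u" | "?h = u" | "u \<preceq>\<^bsub>H\<^esub> ?h" "?h \<noteq> u"
    using H.lle_total[of ?h u] cl by auto
  then show ?thesis
  proof cases
    case 1
    have h: "?h \<in> I" using 1 s t H.mult_nonneg by (simp add: I_iff)
    have "s \<preceq>\<^bsub>H\<^esub> u \<otimes>\<^bsub>H\<^esub> inv\<^bsub>H\<^esub> t" "s \<noteq> u \<otimes>\<^bsub>H\<^esub> inv\<^bsub>H\<^esub> t"
      using 1 cl by (auto simp: H.inv_mult_le_iff H.m_assoc)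
    then have "x \<preceq> w \<otimes> inv y" using N_order[OF s t' _ _ x ny] by simp
    then have xy: "?m = x \<otimes> y"
      using K.meet_absorb(1) cl by (simp add: K.inv_mult_le_iff)
    have "?h \<sqinter>\<^bsub>lgroup_order H\<^esub> u = ?h" using H.meet_absorb(1) 1 cl by simp
    then have "split ?m = (?h, inv d ?h \<otimes> (x \<otimes> y))"
      using split_eq[OF h] m xy by simp
    moreover have "(?h, ?g) \<sqinter>\<^bsub>lgroup_order (lex_prod H infinitesimals)\<^esub> (u, b) = (?h, ?g)"
      using 1 cl g b_closed by (intro L.meet_absorb(1)) (simp_all del: infinitesimals_sel(1))
    ultimately show ?thesis
      unfolding lhs rhs g_eq d_mult[OF s t 1(1)] by simp
  next
    case 2
    have mu: "?m \<in> N u" using m 2 H.meet_absorb(1)[of u u] by simp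
    have du: "d u = d s \<otimes> d t" using d_mult[OF s t] 2 by simp
    \<comment> \<open>Subtracting \<open>d u\<close> on the left preserves the order and carries
      \<open>x + y\<close> to \<open>?g\<close> and \<open>w\<close> to \<open>b\<close>. As
      \<open>?m\<close> lies in the top layer, the result is infinitesimal, so the meet taken in
      \<open>K\<close> is also the meet inside the subgroup.\<close>
    have "?g \<sqinter>\<^bsub>lgroup_order infinitesimals\<^esub> b = inv d u \<otimes> ?m"
    proof (rule Inf.meet_eqI)
      show "inv d u \<otimes> ?m \<in> carrier infinitesimals"
        using quotient_infinitesimal[OF I_ends(2) mu d_mem] by simp
      have mc: "?m \<in> carrier K" "?m \<preceq> x \<otimes> y" "?m \<preceq> w"
        using K.meet_lle[of "x \<otimes> y" w] cl by auto
      then show "inv d u \<otimes> ?m \<preceq>\<^bsub>infinitesimals\<^esub> ?g" "inv d u \<otimes> ?m \<preceq>\<^bsub>infinitesimals\<^esub> b"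
        unfolding g_eq b_def du using cl by simp_all
      fix z assume z: "z \<in> carrier infinitesimals" "z \<preceq>\<^bsub>infinitesimals\<^esub> ?g" "z \<preceq>\<^bsub>infinitesimals\<^esub> b"
      then have "d u \<otimes> z \<preceq> x \<otimes> y" "d u \<otimes> z \<preceq> w"
        unfolding g_eq b_def du using cl by (simp_all add: K.inv_mult_le_iff)
      then have "d u \<otimes> z \<preceq> ?m"
        using K.lle_meet z(1) cl du by simp
      then show "z \<preceq>\<^bsub>infinitesimals\<^esub> inv d u \<otimes> ?m"
        using z(1) mc(1) cl du by (simp add: K.inv_mult_le_iff)
    qed (use g b_closed in auto)
    then show ?thesis
      unfolding lhs rhs split_eq[OF I_ends(2) mu] 2 using lex_meet_same[OF _ g b_closed, of u] by simp
  next
    case 3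
    have "u \<otimes>\<^bsub>H\<^esub> inv\<^bsub>H\<^esub> t \<preceq>\<^bsub>H\<^esub> s" "u \<otimes>\<^bsub>H\<^esub> inv\<^bsub>H\<^esub> t \<noteq> s"
      using 3 cl by (auto simp: H.inv_mult_le_iff H.m_assoc)
    then have "w \<otimes> inv y \<preceq> x" using N_order[OF t' s _ _ ny x] by simp
    then have "?m = w"
      using K.meet_absorb(2) cl by (simp add: K.inv_mult_le_iff)
    moreover have "(?h, ?g) \<sqinter>\<^bsub>lgroup_order (lex_prod H infinitesimals)\<^esub> (u, b) = (u, b)"
      using 3 cl g b_closed by (intro L.meet_absorb(2)) (auto simp del: infinitesimals_sel(1))
    ultimately show ?thesis
      unfolding lhs rhs using split_eq[OF I_ends(2) w_mem] by (simp add: b_def)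
  qed
qed

lemma split_iso: "split \<in> pmv_iso (Gamma K w) lex_interval"
proof -
  have "split (x \<boxplus>\<^bsub>Gamma K w\<^esub> y) = split x \<boxplus>\<^bsub>lex_interval\<^esub> split y"
    if xy: "x \<in> carrier (Gamma K w)" "y \<in> carrier (Gamma K w)" for x y
  proof -
    obtain s t where "s \<in> I" "x \<in> N s" "t \<in> I" "y \<in> N t"
      using xy by (meson K.Gamma_carrier N_cover)
    then show ?thesis using split_padd by blast
  qed
  moreover have "split (lneg (Gamma K w) x) = lneg lex_interval (split x)"
    "split (rneg (Gamma K w) x) = rneg lex_interval (split x)" if x: "x \<in> carrier (Gamma K w)" for x
  proof -
    have n: "lneg (Gamma K w) x = w \<otimes> inv x" "rneg (Gamma K w) x = inv x \<otimes> w"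
      by (simp_all add: Gamma_def)
    obtain t where "t \<in> I" "x \<in> N t"
      using x by (meson K.Gamma_carrier N_cover)
    then show "split (lneg (Gamma K w) x) = lneg lex_interval (split x)"
      "split (rneg (Gamma K w) x) = rneg lex_interval (split x)"
      unfolding n using split_neg by blast+
  qed
  moreover have "split \<one> = (\<one>\<^bsub>H\<^esub>, \<one>)" "split w = (u, b)"
    using split_eq[OF _ one_mem] split_eq[OF _ w_mem] by (simp_all add: d_one b_def)
  ultimately show ?thesis
    using split_bij by (simp add: pmv_iso_def) (simp add: Gamma_def)
qed

lemma representation:
  assumes "c u \<noteq> pone M"
  shows "lex_representation H u M infinitesimals b (split \<circ> \<phi>)"
    "respects_bottom H M (split \<circ> \<phi>) (Mt \<one>\<^bsub>H\<^esub>)"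
proof -
  have "b \<noteq> \<one>"
  proof
    assume "b = \<one>"
    then have "\<phi> (c u) = \<phi> (pone M)"
      using w_eq pmv_isoD(7)[OF iso] d_closed[of u] by (simp add: d_def Gamma_def)
    moreover have "c u \<in> carrier M"
      using cen Mt_sub I_ends(2) unfolding central_system_def by blast
    ultimately show False
      using pmv_isoD(8)[OF iso] closed(5) assms by blast
  qed
  then show "lex_representation H u M infinitesimals b (split \<circ> \<phi>)"
    using Inf.lgroup_axioms b_closed unital_lex[OF b_closed unit_nontrivial] pmv_iso_comp[OF iso split_iso]
    by (simp add: lex_representation_def del: infinitesimals_sel(1))
  have "fst (split (\<phi> x)) = \<one>\<^bsub>H\<^esub> \<longleftrightarrow> x \<in> Mt \<one>\<^bsub>H\<^esub>" if x: "x \<in> carrier M" for x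
  proof -
    obtain t where t: "t \<in> I" "\<phi> x \<in> N t"
      using pmv_isoD(2)[OF iso x] by (meson K.Gamma_carrier N_cover)
    then show ?thesis
      using N_mem_iff[OF _ x] N_disjoint[of t "\<one>\<^bsub>H\<^esub>" "\<phi> x"] by (auto simp: split_eq[OF t])
  qed
  then show "respects_bottom H M (split \<circ> \<phi>) (Mt \<one>\<^bsub>H\<^esub>)"
    unfolding respects_bottom_def using Mt_sub[of "\<one>\<^bsub>H\<^esub>"] by auto
qed

end

section \<open>Trivial \<open>H\<close> and the conclusion\<close>

context perfect_pmv
begin

text \<open>Over a trivial \<open>H\<close> the product \<open>lex_prod H K\<close> is a copy of
  \<open>K\<close>, and the whole unit interval is the only layer. Here \<open>c u\<close> is the
  zero of \<open>M\<close>, so the assumption \<open>nt\<close> says that the constants of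
  \<open>M\<close> differ, and \<open>w\<close> is nonzero.\<close>

lemma representation_trivial:
  assumes u: "u = \<one>\<^bsub>H\<^esub>" and nt: "c u \<noteq> pone M"
  shows "lex_representation H u M K w (\<lambda>x. (\<one>\<^bsub>H\<^esub>, \<phi> x))"
    "respects_bottom H M (\<lambda>x. (\<one>\<^bsub>H\<^esub>, \<phi> x)) (Mt \<one>\<^bsub>H\<^esub>)"
proof -
  interpret lex_product H u K ..
  have trivial: "h = \<one>\<^bsub>H\<^esub>" if "h \<in> carrier H" for h
    using H.trivial_of_unit_one[OF u that] .
  have "c u = pzero M" using cen u by (simp add: central_system_def)
  then have "\<phi> (pzero M) \<noteq> \<phi> (pone M)"
    using nt pmv_isoD(8)[OF iso] closed(4,5) by metis
  then have w: "w \<noteq> \<one>" using pmv_isoD(6,7)[OF iso] by (simp add: Gamma_def)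
  have pow: "(\<one>\<^bsub>H\<^esub>, w) [^]\<^bsub>lex_prod H K\<^esub> n = (\<one>\<^bsub>H\<^esub>, w [^] n)" for n :: nat
    by (simp add: pow_lex)
  have strong: "\<exists>n::nat. inv\<^bsub>lex_prod H K\<^esub> ((u, w) [^]\<^bsub>lex_prod H K\<^esub> n) \<preceq>\<^bsub>lex_prod H K\<^esub> k \<and>
      k \<preceq>\<^bsub>lex_prod H K\<^esub> (u, w) [^]\<^bsub>lex_prod H K\<^esub> n" if k: "k \<in> carrier (lex_prod H K)" for k
  proof -
    obtain g where g: "k = (\<one>\<^bsub>H\<^esub>, g)" "g \<in> carrier K" using k trivial by auto
    then show ?thesis using K.unit_strong[OF g(2)] unfolding u pow g(1) by simp
  qed
  have unital: "unital_lgroup (lex_prod H K) (u, w)"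
    using L.lgroup_axioms strong u by (auto simp: unital_lgroup_def unital_lgroup_axioms_def)
  have bij: "bij_betw (Pair \<one>\<^bsub>H\<^esub>) (carrier (Gamma K w)) (carrier (Gamma (lex_prod H K) (u, w)))"
    unfolding u using trivial by (auto simp: bij_betw_def inj_on_def image_iff)
  have "Pair \<one>\<^bsub>H\<^esub> \<in> pmv_iso (Gamma K w) (Gamma (lex_prod H K) (u, w))"
    unfolding pmv_iso_def using bij lex_meet_same u by (simp add: Gamma_def)
  then have "(\<lambda>x. (\<one>\<^bsub>H\<^esub>, \<phi> x)) \<in> pmv_iso M (Gamma (lex_prod H K) (u, w))"
    using pmv_iso_comp[OF iso] by (fastforce simp: comp_def)
  then show "lex_representation H u M K w (\<lambda>x. (\<one>\<^bsub>H\<^esub>, \<phi> x))"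
    using unital w K.lgroup_axioms by (simp add: lex_representation_def)
  have "I = {\<one>\<^bsub>H\<^esub>}" using trivial I_closed I_ends by blast
  then have "carrier M = Mt \<one>\<^bsub>H\<^esub>" using decD(1) by simp
  then show "respects_bottom H M (\<lambda>x. (\<one>\<^bsub>H\<^esub>, \<phi> x)) (Mt \<one>\<^bsub>H\<^esub>)"
    by (simp add: respects_bottom_def)
qed

lemma representation_exists:
  assumes nt: "c u \<noteq> pone M"
  shows "\<exists>(G :: 'k lgroup) b \<psi>. lex_representation H u M G b \<psi> \<and> respects_bottom H M \<psi> (Mt \<one>\<^bsub>H\<^esub>)"
proof (cases "u = \<one>\<^bsub>H\<^esub>")
  case True
  then show ?thesis using representation_trivial[OF _ nt] by blast
next
  case False
  then interpret perfect_pmv_nontrivial K w H u M \<phi> Mt c by unfold_locales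
  show ?thesis using representation[OF nt] by blast
qed

end

text \<open>Without a condition on \<open>H\<close>, the bottom layer is data that \<open>M\<close>
  alone does not determine; the second part therefore prescribes it. The witness \<open>G\<close> is
  built from elements of \<open>K\<close>, while the competing \<open>G'\<close> may have any
  element type.\<close>

theorem theorem9p2:
  fixes H :: "'h lgroup" and u :: 'h
    and M :: "'a pmv"
    and K :: "'k lgroup" and w :: 'k and \<phi> :: "'a \<Rightarrow> 'k"
  assumes "linear_abelian_unital_lgroup H u"
    and "pseudo_mv_algebra M"
    and "unital_lgroup K w" and "\<phi> \<in> pmv_iso M (Gamma K w)"
    and "weak_perfect H u M K \<phi>"
    and "\<not> strong_perfect H u M K \<phi>"
  shows
    "(\<exists>(G :: 'k lgroup) b \<psi>.
        lex_representation H u M G b \<psi> \<and>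
        (hopfian H u \<longrightarrow>
          (\<forall>(G' :: 'g lgroup) b' \<psi>'.
            lex_representation H u M G' b' \<psi>' \<longrightarrow> lgroup_isomorphic G G'))) \<and>
     (\<forall>Mt. weak_decomposition H u M K \<phi> Mt \<longrightarrow>
        (\<exists>(G :: 'k lgroup) b \<psi>.
          lex_representation H u M G b \<psi> \<and> respects_bottom H M \<psi> (Mt \<one>\<^bsub>H\<^esub>) \<and>
          (\<forall>(G' :: 'g lgroup) b' \<psi>'.
            lex_representation H u M G' b' \<psi>' \<and> respects_bottom H M \<psi>' (Mt \<one>\<^bsub>H\<^esub>) \<longrightarrow>
            lgroup_isomorphic G G')))"
proof -
  have ex: "\<exists>(G :: 'k lgroup) b \<psi>. lex_representation H u M G b \<psi> \<and> respects_bottom H M \<psi> (Mt \<one>\<^bsub>H\<^esub>)"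
    if Mt: "weak_decomposition H u M K \<phi> Mt" for Mt
  proof -
    obtain c where c: "decomposition H u M Mt" "central_system H u M K \<phi> Mt c"
      using Mt unfolding weak_decomposition_def by blast
    then have "perfect_pmv K w H u M \<phi> Mt c"
      using assms(1-4) by (simp add: perfect_pmv_def perfect_pmv_axioms_def)
    \<comment> \<open>Any central system reaching the unit would make \<open>M\<close> strong, so
      the chosen \<open>c\<close> misses it, whichever \<open>Mt\<close> is given.\<close>
    moreover have "c u \<noteq> pone M"
      using c assms(6) unfolding strong_perfect_def by blast
    ultimately show ?thesis by (rule perfect_pmv.representation_exists)
  qed
  show ?thesis
  proof (intro conjI allI impI)
    obtain Mt where "weak_decomposition H u M K \<phi> Mt"
      using assms(5) unfolding weak_perfect_def by blast
    then obtain G :: "'k lgroup" and b \<psi> where G: "lex_representation H u M G b \<psi>"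
      using ex by blast
    show "\<exists>(G :: 'k lgroup) b \<psi>. lex_representation H u M G b \<psi> \<and>
        (hopfian H u \<longrightarrow>
          (\<forall>(G' :: 'g lgroup) b' \<psi>'.
            lex_representation H u M G' b' \<psi>' \<longrightarrow> lgroup_isomorphic G G'))"
      using G by (blast intro: lex_representation_unique_of_hopfian[OF assms(1,2) G])
  next
    fix Mt assume "weak_decomposition H u M K \<phi> Mt"
    then obtain G :: "'k lgroup" and b \<psi>
      where G: "lex_representation H u M G b \<psi>" "respects_bottom H M \<psi> (Mt \<one>\<^bsub>H\<^esub>)"
      using ex by blast
    show "\<exists>(G :: 'k lgroup) b \<psi>.
        lex_representation H u M G b \<psi> \<and> respects_bottom H M \<psi> (Mt \<one>\<^bsub>H\<^esub>) \<and>
        (\<forall>(G' :: 'g lgroup) b' \<psi>'.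
          lex_representation H u M G' b' \<psi>' \<and> respects_bottom H M \<psi>' (Mt \<one>\<^bsub>H\<^esub>) \<longrightarrow>
          lgroup_isomorphic G G')"
      using G by (blast intro: lex_representation_unique_of_bottom[OF assms(1,2) G(1) _ G(2)])
  qed
qed

end
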